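(* Let $\kappa>0$, $\varphi\in BC^2(\mathbb{R}^2)$, and $v_0\in L^2(\mathbb{R}^2)$. Let $C_\star=C_\star(\kappa)>0$ be the maximal regularity constant of $-\kappa\Delta_X$ described in the context. Assume that $$\Vert\nabla_X\varphi\Vert_{L^\infty(\mathbb{R}^2)}\le\frac14\quad\text{and}\quad\Vert\nabla_X\varphi\Vert_{L^\infty(\mathbb{R}^2)}\le\frac{1}{4\sqrt{C_\star}}.$$ Let $v$ be the unique strong solution in $C([0,\infty);L^2(\mathbb{R}^2))\cap C((0,\infty);W^{2,2}(\mathbb{R}^2))\cap C^1((0,\infty);L^2(\mathbb{R}^2))$ of $$\frac{dv}{dt}+Lv=0\ \text{ on }(0,\infty),\qquad v|_{t=0}=v_0.$$ Then $$\lim_{t\to\infty}\Vert G^{1/4}v(t)\Vert_{L^2(\mathbb{R}^2)}=0.$$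
   Context: All functions are real-valued. $BC^2(\mathbb{R}^2)$ is the space of $C^2$ functions which are bounded together with their derivatives up to order 2. $\nabla_X={}^t(\partial_{X_1},\partial_{X_2})$, $\Delta_X=\partial_{X_1}^2+\partial_{X_2}^2$, and $\Vert\nabla_X\varphi\Vert_{L^\infty(\mathbb{R}^2)}$ is the supremum of the Euclidean norm of the gradient. Set $g_1={}^t(1,0,\partial_{X_1}\varphi)$, $g_2={}^t(0,1,\partial_{X_2}\varphi)$, $g_{\alpha\beta}=g_\alpha\cdot g_\beta$, $G=\det(g_{\alpha\beta})=1+(\partial_{X_1}\varphi)^2+(\partial_{X_2}\varphi)^2$, $(g^{\alpha\beta})=(g_{\alpha\beta})^{-1}$; repeated Greek indices are summed over $\{1,2\}$. The operator $L$ on $L^2(\mathbb{R}^2)$ is $$Lf=-\frac{\kappa}{\sqrt{G}}\frac{\partial}{\partial X_\alpha}\Big(\sqrt{G}g^{\alpha\beta}\frac{\partial f}{\partial X_\beta}\Big),\qquad D(L)=W^{2,2}(\mathbb{R}^2).$$ Constant $C_\star$: it is a fixed constant depending only on $\kappa$ such that for every $V_0\in W^{1,2}(\mathbb{R}^2)$ and $F\in L^2(0,\infty;L^2(\mathbb{R}^2))$ the unique solution $V$ of $dV/dt-\kappa\Delta_XV=F$ on $(0,\infty)$, $V|_{t=0}=V_0$, satisfies $$\Vert dV/dt\Vert_{L^2(0,\infty;L^2(\mathbb{R}^2))}+\Vert\kappa\Delta_XV\Vert_{L^2(0,\infty;L^2(\mathbb{R}^2))}\le C_\star\big(\Vert V_0\Vert_{W^{1,2}(\mathbb{R}^2)}+\Vert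 F\Vert_{L^2(0,\infty;L^2(\mathbb{R}^2))}\big).$$ A strong solution is a function in the stated class satisfying the equation in $L^2(\mathbb{R}^2)$ for each $t>0$ and the initial condition; existence and uniqueness of $v$ is established separately in the paper under the first smallness condition. *)

theory Defs
  imports "HOL-Analysis.Analysis"
begin

section \<open>The Hilbert space of square-integrable functions\<close>

definition square_integrable :: "('a::euclidean_space \<Rightarrow> real) \<Rightarrow> bool" where
  "square_integrable f \<longleftrightarrow> f \<in> borel_measurable lborel \<and> integrable lborel (\<lambda>x. (f x)\<^sup>2)"

lemma square_integrable_mult:
  assumes "square_integrable f" "square_integrable g"
  shows "integrable lborel (\<lambda>x. f x * g x)"
proof (rule Bochner_Integration.integrable_bound)
  show "integrable lborel (\<lambda>x. (f x)\<^sup>2 + (g x)\<^sup>2)"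
    using assms by (simp add: square_integrable_def)
  show "(\<lambda>x. f x * g x) \<in> borel_measurable lborel"
    using assms by (auto simp: square_integrable_def)
  have "\<bar>a * b\<bar> \<le> a\<^sup>2 + b\<^sup>2" for a b :: real
  proof -
    have "2 * (\<bar>a\<bar> * \<bar>b\<bar>) \<le> \<bar>a\<bar>\<^sup>2 + \<bar>b\<bar>\<^sup>2"
      using zero_le_power2[of "\<bar>a\<bar> - \<bar>b\<bar>"] by (simp add: power2_diff)
    moreover have "0 \<le> \<bar>a\<bar> * \<bar>b\<bar>" by simp
    ultimately show ?thesis by (simp only: abs_mult power2_abs)
  qed
  then show "AE x in lborel. norm (f x * g x) \<le> norm ((f x)\<^sup>2 + (g x)\<^sup>2)"
    by (simp add: abs_of_nonneg)
qed

lemma square_integrable_zero: "square_integrable (\<lambda>_. 0)"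
  by (simp add: square_integrable_def)

lemma square_integrable_scale:
  assumes "square_integrable f" shows "square_integrable (\<lambda>x. c * f x)"
  using assms by (auto simp: square_integrable_def power_mult_distrib)

lemma square_integrable_add:
  assumes "square_integrable f" "square_integrable g"
  shows "square_integrable (\<lambda>x. f x + g x)"
proof -
  have "integrable lborel (\<lambda>x. (f x)\<^sup>2 + (g x)\<^sup>2 + 2 * (f x * g x))"
    using assms square_integrable_mult[OF assms] by (simp add: square_integrable_def)
  then show ?thesis
    using assms by (auto simp: square_integrable_def power2_sum mult.assoc)
qed

definition L2_rel :: "('a::euclidean_space \<Rightarrow> real) \<Rightarrow> ('a \<Rightarrow> real) \<Rightarrow> bool" where
  "L2_rel f g \<longleftrightarrow> square_integrable f \<and> square_integrable g \<and> (AE x in lborel. f x = g x)"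

quotient_type (overloaded) 'a L2 = "'a::euclidean_space \<Rightarrow> real" / partial: L2_rel
proof (rule part_equivpI)
  show "\<exists>f. L2_rel f (f :: 'a \<Rightarrow> real)"
    using square_integrable_zero by (auto simp: L2_rel_def)
  show "symp (L2_rel :: ('a \<Rightarrow> real) \<Rightarrow> _)"
    by (auto simp: symp_def L2_rel_def)
  show "transp (L2_rel :: ('a \<Rightarrow> real) \<Rightarrow> _)"
    by (auto simp: transp_def L2_rel_def)
qed

instantiation L2 :: (euclidean_space) real_inner
begin

lift_definition zero_L2 :: "'a L2" is "\<lambda>_. 0"
  by (simp add: L2_rel_def square_integrable_zero)

lift_definition plus_L2 :: "'a L2 \<Rightarrow> 'a L2 \<Rightarrow> 'a L2" is "\<lambda>f g x. f x + g x"
  by (auto simp: L2_rel_def square_integrable_add)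

lift_definition scaleR_L2 :: "real \<Rightarrow> 'a L2 \<Rightarrow> 'a L2" is "\<lambda>c f x. c * f x"
  by (auto simp: L2_rel_def square_integrable_scale)

definition uminus_L2 :: "'a L2 \<Rightarrow> 'a L2" where "uminus_L2 u = (-1) *\<^sub>R u"

definition minus_L2 :: "'a L2 \<Rightarrow> 'a L2 \<Rightarrow> 'a L2" where "minus_L2 u w = u + (-1) *\<^sub>R w"

lift_definition inner_L2 :: "'a L2 \<Rightarrow> 'a L2 \<Rightarrow> real" is "\<lambda>f g. \<integral>x. f x * g x \<partial>lborel"
  by (rule integral_cong_AE) (auto simp: L2_rel_def square_integrable_def)

definition norm_L2 :: "'a L2 \<Rightarrow> real" where "norm_L2 u = sqrt (inner u u)"

definition sgn_L2 :: "'a L2 \<Rightarrow> 'a L2" where "sgn_L2 u = inverse (norm u) *\<^sub>R u"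

definition dist_L2 :: "'a L2 \<Rightarrow> 'a L2 \<Rightarrow> real" where "dist_L2 u w = norm (u - w)"

definition uniformity_L2 :: "('a L2 \<times> 'a L2) filter" where
  "uniformity_L2 = (INF e\<in>{0<..}. principal {(u, w). dist u w < e})"

definition open_L2 :: "'a L2 set \<Rightarrow> bool" where
  "open_L2 U = (\<forall>u\<in>U. eventually (\<lambda>(u', w). u' = u \<longrightarrow> w \<in> U) uniformity)"

instance
proof
  fix u w z :: "'a L2" and a b :: real
  show "u + w + z = u + (w + z)"
    by transfer (auto simp: L2_rel_def add.assoc intro!: square_integrable_add)
  show "u + w = w + u"
    by transfer (auto simp: L2_rel_def add.commute intro!: square_integrable_add)
  show "0 + u = u"
    by transfer (auto simp: L2_rel_def)
  show "- u + u = 0"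
    unfolding uminus_L2_def
    by transfer (auto simp: L2_rel_def square_integrable_zero)
  show "u - w = u + - w"
    by (simp add: minus_L2_def uminus_L2_def)
  show "a *\<^sub>R (u + w) = a *\<^sub>R u + a *\<^sub>R w"
    by transfer (auto simp: L2_rel_def distrib_left
        intro!: square_integrable_add square_integrable_scale)
  show "(a + b) *\<^sub>R u = a *\<^sub>R u + b *\<^sub>R u"
    by transfer (auto simp: L2_rel_def distrib_right
        intro!: square_integrable_add square_integrable_scale)
  show "a *\<^sub>R b *\<^sub>R u = (a * b) *\<^sub>R u"
    by transfer (auto simp: L2_rel_def mult.assoc intro!: square_integrable_scale)
  show "1 *\<^sub>R u = u"
    by transfer (auto simp: L2_rel_def)
  show "dist u w = norm (u - w)"
    by (rule dist_L2_def)
  show "sgn u = inverse (norm u) *\<^sub>R u"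
    by (rule sgn_L2_def)
  show "inner u w = inner w u"
    by transfer (simp add: mult.commute)
  show "inner (u + w) z = inner u z + inner w z"
    by transfer (auto simp: L2_rel_def distrib_right square_integrable_mult)
  show "inner (a *\<^sub>R u) w = a * inner u w"
    by transfer (simp add: mult.assoc)
  show "0 \<le> inner u u"
    by transfer simp
  show "inner u u = 0 \<longleftrightarrow> u = 0"
  proof transfer
    fix f :: "'a \<Rightarrow> real" assume "L2_rel f f"
    then have f: "square_integrable f" by (simp add: L2_rel_def)
    have "(\<integral>x. f x * f x \<partial>lborel) = 0 \<longleftrightarrow> (AE x in lborel. f x * f x = 0)"
      using square_integrable_mult[OF f f] by (intro integral_nonneg_eq_0_iff_AE) auto
    then show "(\<integral>x. f x * f x \<partial>lborel) = 0 \<longleftrightarrow> L2_rel f (\<lambda>_. 0)"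
      using f by (simp add: L2_rel_def square_integrable_zero)
  qed
  show "norm u = sqrt (inner u u)"
    by (rule norm_L2_def)
qed (fact uniformity_L2_def open_L2_def)+

end

text \<open>Pointwise multiplication by \<open>m\<close>; meaningful when \<open>m\<close> is bounded and measurable.\<close>

definition mult_L2 :: "('a::euclidean_space \<Rightarrow> real) \<Rightarrow> 'a L2 \<Rightarrow> 'a L2" where
  "mult_L2 m u = abs_L2 (\<lambda>x. m x * rep_L2 u x)"


section \<open>Classical and weak derivatives, Sobolev spaces\<close>

definition partial :: "'n::finite \<Rightarrow> (real^'n \<Rightarrow> real) \<Rightarrow> real^'n \<Rightarrow> real" where
  "partial i f x = frechet_derivative f (at x) (axis i 1)"

definition grad :: "(real^'n::finite \<Rightarrow> real) \<Rightarrow> real^'n \<Rightarrow> real^'n" where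
  "grad f x = (\<chi> i. partial i f x)"

primrec C_class :: "nat \<Rightarrow> (real^'n::finite \<Rightarrow> real) \<Rightarrow> bool" where
  "C_class 0 f \<longleftrightarrow> continuous_on UNIV f"
| "C_class (Suc k) f \<longleftrightarrow> f differentiable_on UNIV \<and> (\<forall>i. C_class k (partial i f))"

primrec BC_class :: "nat \<Rightarrow> (real^'n::finite \<Rightarrow> real) \<Rightarrow> bool" where
  "BC_class 0 f \<longleftrightarrow> continuous_on UNIV f \<and> bounded (range f)"
| "BC_class (Suc k) f \<longleftrightarrow>
     f differentiable_on UNIV \<and> bounded (range f) \<and> (\<forall>i. BC_class k (partial i f))"

definition test_function :: "(real^'n::finite \<Rightarrow> real) \<Rightarrow> bool" where
  "test_function \<psi> \<longleftrightarrow> (\<forall>k. C_class k \<psi>) \<and> compact (closure {x. \<psi> x \<noteq> 0})"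

definition has_weak_partial :: "(real^'n::finite) L2 \<Rightarrow> 'n \<Rightarrow> (real^'n) L2 \<Rightarrow> bool" where
  "has_weak_partial u i w \<longleftrightarrow>
     (\<forall>\<psi>. test_function \<psi> \<longrightarrow>
        (\<integral>x. rep_L2 u x * partial i \<psi> x \<partial>lborel) = - (\<integral>x. rep_L2 w x * \<psi> x \<partial>lborel))"

text \<open>Weak derivatives in \<open>L2\<close> are unique, so the choice below is immaterial.\<close>

definition weak_partial :: "'n::finite \<Rightarrow> (real^'n) L2 \<Rightarrow> (real^'n) L2" where
  "weak_partial i u = (SOME w. has_weak_partial u i w)"

text \<open>The space \<open>W\<^sup>k\<^sup>,\<^sup>2\<close> and its norm.  For \<open>k = 1\<close> the squared norm is
  \<open>\<parallel>u\<parallel>\<^sup>2 + (\<Sum>i. \<parallel>\<partial>\<^sub>i u\<parallel>\<^sup>2)\<close>; in general each \<open>\<partial>\<^sub>i \<partial>\<^sub>j u\<close> is counted once for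
  every ordered pair \<open>(i, j)\<close>.\<close>

primrec sobolev :: "nat \<Rightarrow> (real^'n::finite) L2 \<Rightarrow> bool" where
  "sobolev 0 u \<longleftrightarrow> True"
| "sobolev (Suc k) u \<longleftrightarrow>
     (\<forall>i. (\<exists>w. has_weak_partial u i w) \<and> sobolev k (weak_partial i u))"

primrec sobolev_norm_sq :: "nat \<Rightarrow> (real^'n::finite) L2 \<Rightarrow> real" where
  "sobolev_norm_sq 0 u = (norm u)\<^sup>2"
| "sobolev_norm_sq (Suc k) u = (norm u)\<^sup>2 + (\<Sum>i\<in>UNIV. sobolev_norm_sq k (weak_partial i u))"

definition sobolev_norm :: "nat \<Rightarrow> (real^'n::finite) L2 \<Rightarrow> real" where
  "sobolev_norm k u = sqrt (sobolev_norm_sq k u)"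

definition laplacian :: "(real^'n::finite) L2 \<Rightarrow> (real^'n) L2" where
  "laplacian u = (\<Sum>i\<in>UNIV. weak_partial i (weak_partial i u))"


section \<open>The maximal regularity constant\<close>

text \<open>The Bochner space \<open>L\<^sup>2(0,\<infinity>; X)\<close>: almost everywhere limits of simple functions
  with square-integrable norm.\<close>

definition time_L2 :: "(real \<Rightarrow> 'b::real_normed_vector) \<Rightarrow> bool" where
  "time_L2 F \<longleftrightarrow>
     (\<exists>s. (\<forall>n. simple_function (lebesgue_on {0<..}) (s n)) \<and>
          (AE t in lebesgue_on {0<..}. (\<lambda>n. s n t) \<longlonglongrightarrow> F t)) \<and>
     integrable (lebesgue_on {0<..}) (\<lambda>t. (norm (F t))\<^sup>2)"

definition time_L2_norm :: "(real \<Rightarrow> 'b::real_normed_vector) \<Rightarrow> real" where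
  "time_L2_norm F = sqrt (\<integral>t. (norm (F t))\<^sup>2 \<partial>lebesgue_on {0<..})"

text \<open>\<open>V\<close> solves \<open>dV/dt - \<kappa> \<Delta>V = F\<close>, \<open>V(0) = V\<^sub>0\<close> in the maximal regularity class, with
  weak time derivative \<open>V'\<close>.  That \<open>V\<close> is an antiderivative of \<open>V'\<close> is expressed by the gauge
  integral, which agrees with the Bochner integral for functions in \<open>time_L2\<close>.\<close>

definition heat_solution ::
  "real \<Rightarrow> (real^2) L2 \<Rightarrow> (real \<Rightarrow> (real^2) L2) \<Rightarrow> (real \<Rightarrow> (real^2) L2) \<Rightarrow> (real \<Rightarrow> (real^2) L2) \<Rightarrow> bool"
where
  "heat_solution \<kappa> V\<^sub>0 F V V' \<longleftrightarrow>
     V 0 = V\<^sub>0 \<and>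
     time_L2 V' \<and>
     (\<forall>t\<ge>0. (V' has_integral (V t - V 0)) {0..t}) \<and>
     (AE t in lebesgue_on {0<..}. sobolev 2 (V t) \<and> V' t - \<kappa> *\<^sub>R laplacian (V t) = F t)"

definition maximal_regularity_constant :: "real \<Rightarrow> real \<Rightarrow> bool" where
  "maximal_regularity_constant \<kappa> C \<longleftrightarrow>
     (\<forall>V\<^sub>0 F V V'. sobolev 1 V\<^sub>0 \<and> time_L2 F \<and> heat_solution \<kappa> V\<^sub>0 F V V' \<longrightarrow>
        time_L2_norm V' + time_L2_norm (\<lambda>t. \<kappa> *\<^sub>R laplacian (V t))
          \<le> C * (sobolev_norm 1 V\<^sub>0 + time_L2_norm F))"


section \<open>The Laplace--Beltrami type operator on the graph of \<open>\<phi>\<close>\<close>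

definition tangent :: "(real^2 \<Rightarrow> real) \<Rightarrow> 2 \<Rightarrow> real^2 \<Rightarrow> real^3" where
  "tangent \<phi> \<alpha> x = vector [if \<alpha> = 1 then 1 else 0, if \<alpha> = 2 then 1 else 0, partial \<alpha> \<phi> x]"

definition metric :: "(real^2 \<Rightarrow> real) \<Rightarrow> real^2 \<Rightarrow> real^2^2" where
  "metric \<phi> x = (\<chi> \<alpha> \<beta>. inner (tangent \<phi> \<alpha> x) (tangent \<phi> \<beta> x))"

definition metric_det :: "(real^2 \<Rightarrow> real) \<Rightarrow> real^2 \<Rightarrow> real" where
  "metric_det \<phi> x = det (metric \<phi> x)"

text \<open>The operator \<open>L\<close>; its domain is \<open>sobolev 2\<close>.\<close>

definition surface_op :: "real \<Rightarrow> (real^2 \<Rightarrow> real) \<Rightarrow> (real^2) L2 \<Rightarrow> (real^2) L2" where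
  "surface_op \<kappa> \<phi> f =
     mult_L2 (\<lambda>x. - \<kappa> / sqrt (metric_det \<phi> x))
       (\<Sum>\<alpha>\<in>UNIV. weak_partial \<alpha>
          (\<Sum>\<beta>\<in>UNIV. mult_L2 (\<lambda>x. sqrt (metric_det \<phi> x) * matrix_inv (metric \<phi> x) $ \<alpha> $ \<beta>)
                        (weak_partial \<beta> f)))"

definition strong_solution ::
  "real \<Rightarrow> (real^2 \<Rightarrow> real) \<Rightarrow> (real^2) L2 \<Rightarrow> (real \<Rightarrow> (real^2) L2) \<Rightarrow> bool"
where
  "strong_solution \<kappa> \<phi> v\<^sub>0 v \<longleftrightarrow>
     continuous_on {0..} v \<and>
     (\<forall>t>0. sobolev 2 (v t) \<and> ((\<lambda>s. sobolev_norm 2 (v s - v t)) \<longlongrightarrow> 0) (at t)) \<and>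
     v C1_differentiable_on {0<..} \<and>
     (\<forall>t>0. vector_derivative v (at t) + surface_op \<kappa> \<phi> (v t) = 0) \<and>
     v 0 = v\<^sub>0"

end

theory Submission
  imports Defs
begin

text \<open>
  With respect to the scalar product \<open>\<langle>u, w\<rangle> = \<integral> sqrt G u w\<close> the operator \<open>L\<close> is symmetric and
  nonnegative: \<open>\<langle>L f, h\<rangle> = \<kappa> a(f, h)\<close> for a symmetric form \<open>a\<close> with \<open>a(f, f) \<ge> c \<parallel>\<partial>\<^sub>1 f\<parallel>\<^sup>2\<close>
  (\<open>inner_surface_op\<close>, \<open>dirichlet_coercive\<close>).  The quantity in the theorem is the square root of the
  energy \<open>E(t) = \<langle>v(t), v(t)\<rangle>\<close>, which is nonincreasing because \<open>E' = - 2 \<kappa> a(v, v)\<close>.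

  Two consequences of this structure give the decay.  First, the decrements \<open>E(n) - E(n + 1)\<close> tend
  to zero, so the mean value theorem yields times \<open>\<xi>\<^sub>n\<close> with \<open>\<partial>\<^sub>1 v(\<xi>\<^sub>n) \<rightarrow> 0\<close> in \<open>L\<^sup>2\<close>.  A bounded
  sequence in \<open>L\<^sup>2\<close> of the whole space whose derivative in one direction tends to zero converges
  weakly to zero (\<open>weakly_null\<close>): its pairing with a test function \<open>\<psi>\<close> changes little when \<open>\<psi>\<close> is
  replaced by the mean of \<open>N\<close> disjoint translates of \<open>\<psi>\<close>, and the norm of that mean is
  \<open>\<parallel>\<psi>\<parallel> / sqrt N\<close>.  Hence \<open>v(\<xi>\<^sub>n) \<rightarrow> 0\<close> weakly.  Second, by the symmetry of \<open>L\<close>, the product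
  \<open>\<langle>v(s), v(r)\<rangle>\<close> depends only on \<open>s + r\<close> and so equals \<open>E((s + r) / 2)\<close> (\<open>inner_weighted_flow\<close>).
  Therefore \<open>E((1 + \<xi>\<^sub>n) / 2) = \<langle>v(1), v(\<xi>\<^sub>n)\<rangle> \<rightarrow> 0\<close>: weak convergence against the fixed element \<open>v(1)\<close>
  suffices.  Monotonicity of \<open>E\<close> concludes.

  The weak formulation of \<open>L\<close> requires integration by parts between two functions that have only weak
  derivatives (\<open>weak_integration_by_parts\<close>).  It holds because the difference quotients of a function
  converge weakly to its weak derivative, a statement that passes from test functions to all of \<open>L\<^sup>2\<close>
  by density (\<open>closure_test_L2\<close>).
\<close>

section \<open>The Hilbert space of square-integrable functions\<close>

lemma square_integrable_rep: "square_integrable (rep_L2 u)"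
  using Quotient_rep_reflp[OF Quotient_L2, of u] by (simp add: L2_rel_def)

lemma rep_abs_L2_AE:
  assumes "square_integrable f"
  shows "AE x in lborel. rep_L2 (abs_L2 f) x = f x"
  using Quotient_rep_abs[OF Quotient_L2, of f] assms by (simp add: L2_rel_def)

lemma borel_rep [measurable]: "rep_L2 u \<in> borel_measurable borel"
  using square_integrable_rep[of u] by (simp add: square_integrable_def)

lemma integrable_rep_mult: "integrable lborel (\<lambda>x. rep_L2 u x * rep_L2 w x)"
  by (rule square_integrable_mult[OF square_integrable_rep square_integrable_rep])

lemma abs_L2_eqI:
  assumes "square_integrable f" "square_integrable g" "AE x in lborel. f x = g x"
  shows "abs_L2 f = abs_L2 g"
  by (rule Quotient_rel_abs[OF Quotient_L2]) (use assms in \<open>simp add: L2_rel_def\<close>)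

lemma abs_rep_L2: "abs_L2 (rep_L2 u) = u"
  using Quotient_abs_rep[OF Quotient_L2] .

lemma inner_L2_rep: "inner u w = (\<integral>x. rep_L2 u x * rep_L2 w x \<partial>lborel)"
  by (simp add: inner_L2.rep_eq)

lemma inner_abs_L2:
  assumes f: "square_integrable f"
  shows "inner u (abs_L2 f) = (\<integral>x. rep_L2 u x * f x \<partial>lborel)"
proof -
  have [measurable]: "f \<in> borel_measurable borel"
    using f by (simp add: square_integrable_def)
  show ?thesis
    unfolding inner_L2_rep using rep_abs_L2_AE[OF f]
    by (intro integral_cong_AE) auto
qed

lemma abs_L2_add:
  assumes "square_integrable f" "square_integrable g"
  shows "abs_L2 f + abs_L2 g = abs_L2 (\<lambda>x. f x + g x)"
  using assms by (subst plus_L2.abs_eq) (auto simp: L2_rel_def)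

lemma abs_L2_scale:
  assumes "square_integrable f"
  shows "c *\<^sub>R abs_L2 f = abs_L2 (\<lambda>x. c * f x)"
  using assms by (subst scaleR_L2.abs_eq) (auto simp: L2_rel_def)

lemma square_integrable_diff:
  assumes "square_integrable f" "square_integrable g"
  shows "square_integrable (\<lambda>x. f x - g x)"
  using square_integrable_add[OF assms(1) square_integrable_scale[OF assms(2), of "-1"]] by simp

lemma abs_L2_diff:
  assumes "square_integrable f" "square_integrable g"
  shows "abs_L2 f - abs_L2 g = abs_L2 (\<lambda>x. f x - g x)"
proof -
  have "abs_L2 f - abs_L2 g = abs_L2 f + (-1) *\<^sub>R abs_L2 g"
    by simp
  then show ?thesis
    using assms square_integrable_scale[of g "-1"] by (simp only: abs_L2_add abs_L2_scale) simp
qed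

lemma norm_abs_L2:
  assumes "square_integrable f"
  shows "(norm (abs_L2 f))\<^sup>2 = (\<integral>x. (f x)\<^sup>2 \<partial>lborel)"
proof -
  have [measurable]: "f \<in> borel_measurable borel"
    using assms by (simp add: square_integrable_def)
  have "(norm (abs_L2 f))\<^sup>2 = (\<integral>x. rep_L2 (abs_L2 f) x * f x \<partial>lborel)"
    by (simp add: power2_norm_eq_inner inner_abs_L2 assms)
  also have "\<dots> = (\<integral>x. (f x)\<^sup>2 \<partial>lborel)"
    using rep_abs_L2_AE[OF assms] by (intro integral_cong_AE) (auto simp: power2_eq_square)
  finally show ?thesis .
qed

lemma square_integrable_bound:
  assumes "square_integrable g" "f \<in> borel_measurable borel" "\<And>x. \<bar>f x\<bar> \<le> \<bar>g x\<bar>"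
  shows "square_integrable f"
  unfolding square_integrable_def
proof
  show "integrable lborel (\<lambda>x. (f x)\<^sup>2)"
  proof (rule Bochner_Integration.integrable_bound)
    show "integrable lborel (\<lambda>x. (g x)\<^sup>2)"
      using assms by (simp add: square_integrable_def)
    show "(\<lambda>x. (f x)\<^sup>2) \<in> borel_measurable lborel"
      using assms(2) by simp
    show "AE x in lborel. norm ((f x)\<^sup>2) \<le> norm ((g x)\<^sup>2)"
      using assms(3) by (simp add: abs_le_square_iff)
  qed
qed (use assms in simp)

lemma abs_L2_dominated_convergence:
  assumes g: "square_integrable g"
    and meas: "\<And>n. F n \<in> borel_measurable borel" "f \<in> borel_measurable borel"
    and bound: "\<And>n x. \<bar>F n x\<bar> \<le> \<bar>g x\<bar>"
    and lim: "\<And>x. (\<lambda>n::nat. F n x) \<longlonglongrightarrow> f x"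
  shows "(\<lambda>n. abs_L2 (F n)) \<longlonglongrightarrow> abs_L2 f"
proof -
  note [measurable] = meas
  have fb: "\<bar>f x\<bar> \<le> \<bar>g x\<bar>" for x
    by (rule LIMSEQ_le_const2[OF tendsto_rabs[OF lim[of x]]]) (use bound in auto)
  have sF: "square_integrable (F n)" for n
    by (rule square_integrable_bound[OF g]) (use bound in auto)
  have sf: "square_integrable f"
    by (rule square_integrable_bound[OF g]) (use fb in auto)
  have "(\<lambda>n. \<integral>x. (F n x - f x)\<^sup>2 \<partial>lborel) \<longlonglongrightarrow> (\<integral>x. 0 \<partial>(lborel :: 'a measure))"
  proof (rule integral_dominated_convergence)
    show "integrable lborel (\<lambda>x. 4 * (g x)\<^sup>2)"
      using g by (simp add: square_integrable_def)
    show "AE x in lborel. (\<lambda>n. (F n x - f x)\<^sup>2) \<longlonglongrightarrow> 0"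
    proof (intro always_eventually allI)
      fix x
      show "(\<lambda>n. (F n x - f x)\<^sup>2) \<longlonglongrightarrow> 0"
        using tendsto_power[OF tendsto_diff[OF lim[of x] tendsto_const[of "f x"]], of 2] by simp
    qed
    show "AE x in lborel. norm ((F n x - f x)\<^sup>2) \<le> 4 * (g x)\<^sup>2" for n
    proof (intro always_eventually allI)
      fix x
      have "\<bar>F n x - f x\<bar> \<le> \<bar>2 * g x\<bar>"
        using bound[of n x] fb[of x] by linarith
      then show "norm ((F n x - f x)\<^sup>2) \<le> 4 * (g x)\<^sup>2"
        by (simp add: abs_le_square_iff power_mult_distrib)
    qed
  qed auto
  then have "(\<lambda>n. (norm (abs_L2 (F n) - abs_L2 f))\<^sup>2) \<longlonglongrightarrow> 0"
    by (simp add: abs_L2_diff norm_abs_L2 square_integrable_diff sF sf)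
  then have "(\<lambda>n. sqrt ((norm (abs_L2 (F n) - abs_L2 f))\<^sup>2)) \<longlonglongrightarrow> sqrt 0"
    by (rule tendsto_real_sqrt)
  then show ?thesis
    by (simp add: LIM_zero_iff tendsto_norm_zero_iff)
qed

section \<open>Translations\<close>

lemma lborel_integral_translation:
  fixes f :: "'a::euclidean_space \<Rightarrow> real"
  assumes [measurable]: "f \<in> borel_measurable borel"
  shows "(\<integral>x. f (x + h) \<partial>lborel) = (\<integral>x. f x \<partial>lborel)"
proof -
  have "(\<integral>x. f x \<partial>lborel) = (\<integral>x. f x \<partial>distr lborel borel ((+) h))"
    by (simp add: lborel_distr_plus)
  also have "\<dots> = (\<integral>x. f (h + x) \<partial>lborel)"
    by (subst integral_distr) auto
  finally show ?thesis by (simp add: add.commute)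
qed

lemma square_integrable_translation:
  fixes f :: "'a::euclidean_space \<Rightarrow> real"
  assumes "square_integrable f"
  shows "square_integrable (\<lambda>x. f (x + h))"
proof -
  have [measurable]: "f \<in> borel_measurable borel"
    using assms by (simp add: square_integrable_def)
  have "integrable (distr lborel borel ((+) h)) (\<lambda>x. (f x)\<^sup>2)"
    using assms by (simp add: lborel_distr_plus square_integrable_def)
  then have "integrable lborel (\<lambda>x. (f (h + x))\<^sup>2)"
    by (subst (asm) integrable_distr_eq) auto
  then show ?thesis
    by (simp add: square_integrable_def add.commute)
qed

lemma AE_lborel_translation:
  fixes P :: "'a::euclidean_space \<Rightarrow> bool"
  assumes "AE x in lborel. P x"
  shows "AE x in lborel. P (x + h)"
proof -
  have "AE x in distr lborel borel ((+) h). P x"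
    unfolding lborel_distr_plus by (rule assms)
  then have "AE x in lborel. P (h + x)"
    by (rule AE_distrD[rotated]) auto
  then show ?thesis by (simp add: add.commute)
qed

text \<open>Translation by \<open>h\<close>, that is, the map \<open>f \<mapsto> f (\<cdot> + h)\<close>.\<close>

lift_definition translate_L2 :: "'a \<Rightarrow> 'a::euclidean_space L2 \<Rightarrow> 'a L2" is "\<lambda>h f x. f (x + h)"
  by (auto simp: L2_rel_def square_integrable_translation
      AE_lborel_translation[where P = "\<lambda>x. _ x = _ x"])

lemma translate_abs_L2:
  "square_integrable f \<Longrightarrow> translate_L2 h (abs_L2 f) = abs_L2 (\<lambda>x. f (x + h))"
  by (simp add: translate_L2.abs_eq L2_rel_def)

lemma translate_L2_add: "translate_L2 h (u + w) = translate_L2 h u + translate_L2 h w"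
  by transfer (auto simp: L2_rel_def intro!: square_integrable_translation square_integrable_add)

lemma translate_L2_scaleR: "translate_L2 h (c *\<^sub>R u) = c *\<^sub>R translate_L2 h u"
  by transfer (auto simp: L2_rel_def intro!: square_integrable_translation square_integrable_scale)

lemma translate_L2_diff: "translate_L2 h (u - w) = translate_L2 h u - translate_L2 h w"
  using translate_L2_add[of h u "- w"] translate_L2_scaleR[of h "-1" w] by simp

lemma translate_L2_translate: "translate_L2 h (translate_L2 k u) = translate_L2 (h + k) u"
  by transfer (auto simp: L2_rel_def add.assoc intro!: square_integrable_translation)

lemma translate_L2_zero: "translate_L2 0 u = u"
  by transfer (auto simp: L2_rel_def)

lemma inner_translate_L2: "inner (translate_L2 h u) (translate_L2 h w) = inner u w"
proof transfer
  fix h and f g :: "'a \<Rightarrow> real"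
  assume "L2_rel f f" "L2_rel g g"
  then have [measurable]: "f \<in> borel_measurable borel" "g \<in> borel_measurable borel"
    by (auto simp: L2_rel_def square_integrable_def)
  show "(\<integral>x. f (x + h) * g (x + h) \<partial>lborel) = (\<integral>x. f x * g x \<partial>lborel)"
    using lborel_integral_translation[of "\<lambda>x. f x * g x" h] by simp
qed

lemma norm_translate_L2: "norm (translate_L2 h u) = norm u"
  by (simp add: norm_eq_sqrt_inner inner_translate_L2)

lemma inner_translate_left: "inner (translate_L2 h u) w = inner u (translate_L2 (- h) w)"
  using inner_translate_L2[of h u "translate_L2 (- h) w"]
  by (simp add: translate_L2_translate translate_L2_zero)

section \<open>Multiplication operators\<close>

lemma square_integrable_mult_bounded:
  assumes "m \<in> borel_measurable borel" "bounded (range m)" "square_integrable f"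
  shows "square_integrable (\<lambda>x. m x * f x)"
proof -
  obtain B where B: "\<And>x. \<bar>m x\<bar> \<le> B"
    using assms(2) by (auto simp: bounded_iff)
  have [measurable]: "m \<in> borel_measurable borel" "f \<in> borel_measurable borel"
    using assms by (auto simp: square_integrable_def)
  show ?thesis
  proof (rule square_integrable_bound[OF square_integrable_scale[OF assms(3), of B]])
    show "\<bar>m x * f x\<bar> \<le> \<bar>B * f x\<bar>" for x
      using B[of x] by (simp add: abs_mult mult_right_mono)
  qed auto
qed

text \<open>Bounded Borel functions; for these \<open>mult_L2\<close> is a bounded operator.\<close>

definition L2_multiplier :: "('a::euclidean_space \<Rightarrow> real) \<Rightarrow> bool" where
  "L2_multiplier m \<longleftrightarrow> m \<in> borel_measurable borel \<and> bounded (range m)"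

context
  fixes m :: "'a::euclidean_space \<Rightarrow> real"
  assumes m: "L2_multiplier m"
begin

lemma inner_mult_L2_right: "inner w (mult_L2 m u) = (\<integral>x. m x * (rep_L2 w x * rep_L2 u x) \<partial>lborel)"
  unfolding mult_L2_def using m
  by (subst inner_abs_L2)
     (auto simp: L2_multiplier_def mult_ac square_integrable_mult_bounded square_integrable_rep)

lemma inner_mult_L2_left: "inner (mult_L2 m u) w = (\<integral>x. m x * (rep_L2 u x * rep_L2 w x) \<partial>lborel)"
  by (subst inner_commute) (simp add: inner_mult_L2_right mult_ac)

lemma inner_mult_L2_commute: "inner (mult_L2 m u) w = inner u (mult_L2 m w)"
  by (simp add: inner_mult_L2_left inner_mult_L2_right)

lemma integrable_multiplier: "integrable lborel (\<lambda>x. m x * (rep_L2 u x * rep_L2 w x))"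
  using square_integrable_mult[OF square_integrable_mult_bounded[OF _ _ square_integrable_rep] square_integrable_rep]
    m by (force simp: L2_multiplier_def mult.assoc)

lemma mult_L2_abs:
  assumes f: "square_integrable f"
  shows "mult_L2 m (abs_L2 f) = abs_L2 (\<lambda>x. m x * f x)"
  unfolding mult_L2_def
proof (rule abs_L2_eqI)
  show "square_integrable (\<lambda>x. m x * rep_L2 (abs_L2 f) x)" "square_integrable (\<lambda>x. m x * f x)"
    using m f by (auto simp: L2_multiplier_def square_integrable_mult_bounded square_integrable_rep)
  show "AE x in lborel. m x * rep_L2 (abs_L2 f) x = m x * f x"
    using rep_abs_L2_AE[OF f] by auto
qed

lemma bounded_linear_mult_L2: "bounded_linear (mult_L2 m)"
proof -
  obtain B where B: "\<And>x. \<bar>m x\<bar> \<le> B"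
    using m by (auto simp: bounded_iff L2_multiplier_def)
  have sq: "square_integrable (\<lambda>x. m x * rep_L2 u x)" for u
    using m by (auto simp: L2_multiplier_def square_integrable_mult_bounded square_integrable_rep)
  show ?thesis
  proof (rule bounded_linear_intro[where K = B])
    fix u w :: "'a L2" and c :: real
    show "mult_L2 m (u + w) = mult_L2 m u + mult_L2 m w"
      using sq[of u] sq[of w] square_integrable_add[OF square_integrable_rep square_integrable_rep, of u w]
        abs_L2_add[OF square_integrable_rep square_integrable_rep, of u w]
      by (auto simp: mult_L2_abs abs_L2_add abs_rep_L2 distrib_left mult_L2_def[of m u] mult_L2_def[of m w])
    show "mult_L2 m (c *\<^sub>R u) = c *\<^sub>R mult_L2 m u"
      using sq[of u] square_integrable_scale[OF square_integrable_rep, of c u]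
        abs_L2_scale[OF square_integrable_rep, of c u]
      by (auto simp: mult_L2_abs abs_L2_scale abs_rep_L2 mult_ac mult_L2_def[of m u])
    have "(norm (mult_L2 m u))\<^sup>2 = (\<integral>x. (m x * rep_L2 u x)\<^sup>2 \<partial>lborel)"
      unfolding mult_L2_def by (rule norm_abs_L2[OF sq])
    also have "\<dots> \<le> (\<integral>x. B\<^sup>2 * (rep_L2 u x)\<^sup>2 \<partial>lborel)"
    proof (rule integral_mono)
      show "integrable lborel (\<lambda>x. (m x * rep_L2 u x)\<^sup>2)"
        using sq[of u] by (simp add: square_integrable_def)
      show "integrable lborel (\<lambda>x. B\<^sup>2 * (rep_L2 u x)\<^sup>2)"
        using square_integrable_rep[of u] by (simp add: square_integrable_def)
      show "(m x * rep_L2 u x)\<^sup>2 \<le> B\<^sup>2 * (rep_L2 u x)\<^sup>2" for x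
        using B[of x] by (auto simp: power_mult_distrib abs_le_square_iff[symmetric] intro!: mult_right_mono)
    qed
    also have "\<dots> = (norm u * B)\<^sup>2"
      using norm_abs_L2[OF square_integrable_rep, of u] by (simp add: abs_rep_L2 power_mult_distrib)
    finally show "norm (mult_L2 m u) \<le> norm u * B"
      using B[of undefined] by (auto intro: power2_le_imp_le)
  qed
qed

end

lemma mult_L2_mult:
  assumes "L2_multiplier m" "L2_multiplier k"
  shows "mult_L2 m (mult_L2 k u) = mult_L2 (\<lambda>x. m x * k x) u"
  unfolding mult_L2_def[of k] using assms
  by (subst mult_L2_abs)
     (auto simp: mult_L2_def L2_multiplier_def mult.assoc square_integrable_mult_bounded square_integrable_rep)

lemma inner_mult_L2_swap: "L2_multiplier m \<Longrightarrow> inner (mult_L2 m u) w = inner (mult_L2 m w) u"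
  by (simp add: inner_mult_L2_left mult.commute)

lemma mult_L2_const: "mult_L2 (\<lambda>_. c) u = c *\<^sub>R u"
  unfolding mult_L2_def abs_L2_scale[OF square_integrable_rep, symmetric] abs_rep_L2 ..

section \<open>Smooth functions\<close>

lemma partial_eq:
  fixes f :: "real^'n::finite \<Rightarrow> real"
  assumes "(f has_derivative D) (at x)"
  shows "partial i f x = D (axis i 1)"
  using frechet_derivative_at[OF assms] by (simp add: partial_def)

lemma has_derivative_frechet:
  "f differentiable_on UNIV \<Longrightarrow> (f has_derivative frechet_derivative f (at x)) (at x)"
  by (simp add: differentiable_on_def frechet_derivative_works)

lemma partial_const: "partial i (\<lambda>_. c) = (\<lambda>_. 0)"
  by (rule ext, rule partial_eq[where D = "\<lambda>_. 0"]) auto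

lemma partial_add:
  assumes "f differentiable_on UNIV" "g differentiable_on UNIV"
  shows "partial i (\<lambda>x. f x + g x) = (\<lambda>x. partial i f x + partial i g x)"
proof
  fix x
  show "partial i (\<lambda>x. f x + g x) x = partial i f x + partial i g x"
    by (rule partial_eq[OF has_derivative_add[OF assms[THEN has_derivative_frechet]], THEN trans])
       (simp add: partial_def)
qed

lemma partial_mult:
  assumes "f differentiable_on UNIV" "g differentiable_on UNIV"
  shows "partial i (\<lambda>x. f x * g x) = (\<lambda>x. f x * partial i g x + partial i f x * g x)"
proof
  fix x
  show "partial i (\<lambda>x. f x * g x) x = f x * partial i g x + partial i f x * g x"
    by (rule partial_eq[OF has_derivative_mult[OF assms[THEN has_derivative_frechet]], THEN trans])
       (simp add: partial_def)
qed

text \<open>The chain rule for an outer function of one real variable.\<close>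

lemma partial_compose:
  fixes f :: "real^'n::finite \<Rightarrow> real"
  assumes h: "\<And>x. (h has_real_derivative h' (f x)) (at (f x))" and f: "f differentiable_on UNIV"
  shows "(\<lambda>x. h (f x)) differentiable_on UNIV"
    and "partial i (\<lambda>x. h (f x)) = (\<lambda>x. h' (f x) * partial i f x)"
proof -
  have *: "((\<lambda>x. h (f x)) has_derivative (\<lambda>v. h' (f x) * frechet_derivative f (at x) v)) (at x)" for x
    using has_derivative_compose[OF has_derivative_frechet[OF f, of x] h[unfolded has_field_derivative_def]]
    by simp
  show "(\<lambda>x. h (f x)) differentiable_on UNIV"
    using * by (auto simp: differentiable_on_def differentiable_def)
  show "partial i (\<lambda>x. h (f x)) = (\<lambda>x. h' (f x) * partial i f x)"
    by (rule ext, rule partial_eq[OF *, THEN trans]) (simp add: partial_def)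
qed

lemma C_class_continuous: "C_class k f \<Longrightarrow> continuous_on UNIV f"
  by (cases k) (auto intro: differentiable_imp_continuous_on)

lemma C_class_SucD: "C_class (Suc k) f \<Longrightarrow> C_class k f"
  by (induction k arbitrary: f) (auto intro: differentiable_imp_continuous_on)

lemma C_class_const: "C_class k (\<lambda>_. c)"
  by (induction k arbitrary: c) (auto simp: partial_const)

lemma C_class_add: "C_class k f \<Longrightarrow> C_class k g \<Longrightarrow> C_class k (\<lambda>x. f x + g x)"
  by (induction k arbitrary: f g) (auto simp: partial_add intro!: continuous_intros derivative_intros)

lemma C_class_mult: "C_class k f \<Longrightarrow> C_class k g \<Longrightarrow> C_class k (\<lambda>x. f x * g x)"
proof (induction k arbitrary: f g)
  case (Suc k)
  then have "C_class k f" "C_class k g"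
    by (metis C_class_SucD)+
  with Suc show ?case
    by (auto simp: partial_mult intro!: C_class_add derivative_intros)
qed (auto intro: continuous_intros)

lemma C_class_scale: "C_class k f \<Longrightarrow> C_class k (\<lambda>x. c * f x)"
  by (rule C_class_mult[OF C_class_const])

lemma C_class_prod: "(\<And>i. i \<in> I \<Longrightarrow> C_class k (f i)) \<Longrightarrow> C_class k (\<lambda>x. \<Prod>i\<in>I. f i x)"
  by (induction I rule: infinite_finite_induct) (auto simp: C_class_const C_class_mult)

lemma C_class_exp: "C_class k f \<Longrightarrow> C_class k (\<lambda>x. exp (f x))"
proof (induction k arbitrary: f)
  case (Suc k)
  have "(exp has_real_derivative exp (f x)) (at (f x))" for x
    by (auto intro!: derivative_eq_intros)
  note c = partial_compose[of exp exp f, OF this]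
  have "C_class k (\<lambda>x. exp (f x))"
    using Suc.IH C_class_SucD[OF Suc.prems] by blast
  with Suc.prems c show ?case
    by (auto intro!: C_class_mult)
qed (auto intro: continuous_intros)

text \<open>The function \<open>exp (- 1 / x)\<close>, extended by zero to \<open>x \<le> 0\<close>, and its products with powers of
  \<open>1 / x\<close>.  The linear span of this family is closed under differentiation.\<close>

definition flat :: "nat \<Rightarrow> real \<Rightarrow> real" where
  "flat n x = (if x > 0 then (1 / x) ^ n * exp (- (1 / x)) else 0)"

lemma flat_tendsto_0: "(flat n \<longlongrightarrow> 0) (at_right 0)"
proof -
  have "((\<lambda>x::real. (inverse x) ^ n / exp (inverse x)) \<longlongrightarrow> 0) (at_right 0)"
    by (rule filterlim_compose[OF tendsto_power_div_exp_0 filterlim_inverse_at_top_right])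
  moreover have "eventually (\<lambda>x. (inverse x) ^ n / exp (inverse x) = flat n x) (at_right (0::real))"
    by (auto simp: eventually_at_right_field flat_def exp_minus divide_simps intro!: exI[of _ 1])
  ultimately show ?thesis
    by (rule Lim_transform_eventually)
qed

lemma flat_has_derivative:
  "(flat n has_real_derivative (flat (n + 2) x - real n * flat (n + 1) x)) (at x)"
proof -
  consider "x > 0" | "x < 0" | "x = 0" by linarith
  then show ?thesis
  proof cases
    case 1
    have "((\<lambda>x. (1 / x) ^ n * exp (- (1 / x))) has_real_derivative
        (flat (n + 2) x - real n * flat (n + 1) x)) (at x)"
    proof -
      have y: "((\<lambda>x. 1 / x) has_real_derivative - ((1 / x)\<^sup>2)) (at x)"
        using 1 by (auto intro!: derivative_eq_intros simp: power2_eq_square)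
      have g: "((\<lambda>y. y ^ n * exp (- y)) has_real_derivative
          real n * y ^ (n - 1) * exp (- y) - y ^ n * exp (- y)) (at y)" for y :: real
        by (auto intro!: derivative_eq_intros)
      have "(real n * y ^ (n - 1) * exp (- y) - y ^ n * exp (- y)) * - (y\<^sup>2)
          = y ^ (n + 2) * exp (- y) - real n * (y ^ (n + 1) * exp (- y))" for y :: real
        by (cases n) (simp_all add: algebra_simps power2_eq_square)
      with DERIV_chain2[OF g y] 1 show ?thesis
        by (simp add: flat_def)
    qed
    then show ?thesis
      by (rule DERIV_cong_ev[OF refl _ refl, THEN iffD1, rotated])
         (use 1 eventually_nhds_in_open[of "{0<..}" x] in \<open>auto simp: flat_def elim: eventually_mono\<close>)
  next
    case 2
    have "((\<lambda>x. 0) has_real_derivative (flat (n + 2) x - real n * flat (n + 1) x)) (at x)"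
      using 2 by (simp add: flat_def)
    then show ?thesis
      by (rule DERIV_cong_ev[OF refl _ refl, THEN iffD1, rotated])
         (use 2 eventually_nhds_in_open[of "{..<0}" x] in \<open>auto simp: flat_def elim: eventually_mono\<close>)
  next
    case 3
    have "((\<lambda>h. (flat n h - flat n 0) / h) \<longlongrightarrow> 0) (at 0)"
    proof (rule filterlim_split_at)
      show "((\<lambda>h. (flat n h - flat n 0) / h) \<longlongrightarrow> 0) (at_left 0)"
        by (rule tendsto_eventually) (auto simp: eventually_at_left_field flat_def intro!: exI[of _ "-1"])
      show "((\<lambda>h. (flat n h - flat n 0) / h) \<longlongrightarrow> 0) (at_right 0)"
        by (rule Lim_transform_eventually[OF flat_tendsto_0[of "Suc n"]])
           (auto simp: eventually_at_right_field flat_def intro!: exI[of _ 1])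
    qed
    then show ?thesis
      using 3 by (simp add: has_field_derivative_iff flat_def)
  qed
qed

lemma has_derivative_affine_coordinate:
  "((\<lambda>x::real^'n::finite. c * (x $ j) + d) has_derivative (\<lambda>v. c * (v $ j))) (at x)"
  by (auto intro!: derivative_eq_intros bounded_linear.has_derivative[OF bounded_linear_vec_nth])

lemma C_class_flat: "C_class k (\<lambda>x::real^'n::finite. flat n (c * (x $ j) + d))"
proof (induction k arbitrary: n)
  case 0
  have "continuous_on UNIV (flat n)"
    by (rule DERIV_continuous_on) (rule DERIV_subset[OF flat_has_derivative], simp)
  then have "continuous_on UNIV (flat n \<circ> (\<lambda>x::real^'n. c * (x $ j) + d))"
    by (intro continuous_on_compose continuous_intros) (auto intro: continuous_on_subset)
  then show ?case
    by (simp add: o_def)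
next
  case (Suc k)
  have d: "(\<lambda>x::real^'n. c * (x $ j) + d) differentiable_on UNIV"
    using has_derivative_affine_coordinate unfolding differentiable_on_def differentiable_def by blast
  note c = partial_compose[of "flat n" "\<lambda>y. flat (n + 2) y - real n * flat (n + 1) y"
      "\<lambda>x::real^'n. c * (x $ j) + d", OF flat_has_derivative d]
  have "C_class k (\<lambda>x::real^'n. flat (n + 2) (c * (x $ j) + d) + (- real n) * flat (n + 1) (c * (x $ j) + d))"
    by (intro C_class_add C_class_scale Suc.IH)
  moreover have "partial i (\<lambda>x::real^'n. c * (x $ j) + d) = (\<lambda>_. c * (axis i 1 $ j))" for i
    by (rule ext, rule partial_eq[OF has_derivative_affine_coordinate])
  ultimately show ?case
    using c by (auto intro!: C_class_mult C_class_const)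
qed

section \<open>Density of the test functions\<close>

lemma test_functionI:
  assumes "\<And>k. C_class k \<psi>" "bounded {x. \<psi> x \<noteq> 0}"
  shows "test_function \<psi>"
  using assms by (simp add: test_function_def compact_closure)

lemma test_functionD:
  assumes "test_function \<psi>"
  shows "C_class k \<psi>" "continuous_on UNIV \<psi>" "bounded {x. \<psi> x \<noteq> 0}"
  using assms by (auto simp: test_function_def compact_closure intro: C_class_continuous)

lemma square_integrable_bounded_support:
  fixes f :: "'a::euclidean_space \<Rightarrow> real"
  assumes f: "f \<in> borel_measurable borel" and B: "\<And>x. \<bar>f x\<bar> \<le> B" and S: "bounded {x. f x \<noteq> 0}"
  shows "square_integrable f"
proof -
  obtain a b where ab: "{x. f x \<noteq> 0} \<subseteq> cbox a b"
    using bounded_subset_cbox_symmetric[OF S] by blast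
  have "integrable lborel (\<lambda>x. indicator (cbox a b) x :: real)"
    by (simp add: emeasure_lborel_cbox_eq)
  then have "square_integrable (\<lambda>x. indicator (cbox a b) x :: real)"
    by (simp add: square_integrable_def indicator_def[abs_def] of_bool_def if_distrib[of "\<lambda>y. y\<^sup>2"]
        cong: if_cong)
  from square_integrable_scale[OF this, of B] show ?thesis
    by (rule square_integrable_bound)
       (use f B ab in \<open>auto simp: indicator_def intro: order_trans[OF B abs_ge_self]\<close>)
qed

lemma continuous_bounded_support_bounded:
  fixes f :: "'a::euclidean_space \<Rightarrow> real"
  assumes "continuous_on UNIV f" "bounded {x. f x \<noteq> 0}"
  shows "\<exists>B. \<forall>x. \<bar>f x\<bar> \<le> B"
proof -
  have "compact (f ` closure {x. f x \<noteq> 0})"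
    using assms by (intro compact_continuous_image) (auto simp: compact_closure intro: continuous_on_subset)
  then obtain B where B: "\<And>x. x \<in> closure {x. f x \<noteq> 0} \<Longrightarrow> \<bar>f x\<bar> \<le> B"
    using compact_imp_bounded by (fastforce simp: bounded_iff)
  have "\<bar>f x\<bar> \<le> max B 0" for x
    using B[of x] closure_subset[of "{x. f x \<noteq> 0}"] by (cases "f x = 0") force+
  then show ?thesis by blast
qed

lemma square_integrable_continuous:
  fixes f :: "'a::euclidean_space \<Rightarrow> real"
  assumes "continuous_on UNIV f" "bounded {x. f x \<noteq> 0}"
  shows "square_integrable f"
proof -
  obtain B where "\<And>x. \<bar>f x\<bar> \<le> B"
    using continuous_bounded_support_bounded[OF assms] by blast
  with assms show ?thesis
    by (intro square_integrable_bounded_support) (auto intro: borel_measurable_continuous_onI)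
qed

lemma square_integrable_test: "test_function \<psi> \<Longrightarrow> square_integrable \<psi>"
  by (auto dest: test_functionD intro!: square_integrable_continuous)

text \<open>The test functions, as elements of \<open>L\<^sup>2\<close>.\<close>

definition test_L2 :: "((real^'n::finite) L2) set" where
  "test_L2 = abs_L2 ` {\<psi>. test_function \<psi>}"

lemma subspace_test_L2: "subspace (test_L2 :: ((real^'n::finite) L2) set)"
proof (rule subspaceI)
  show "0 \<in> (test_L2 :: ((real^'n) L2) set)"
    unfolding test_L2_def zero_L2_def
    by (rule imageI) (simp add: test_functionI C_class_const)
next
  fix u w :: "(real^'n) L2" assume "u \<in> test_L2" "w \<in> test_L2"
  then obtain f g where f: "test_function f" "u = abs_L2 f" and g: "test_function g" "w = abs_L2 g"
    by (auto simp: test_L2_def)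
  have "{x. f x + g x \<noteq> 0} \<subseteq> {x. f x \<noteq> 0} \<union> {x. g x \<noteq> 0}" by auto
  then have "bounded {x. f x + g x \<noteq> 0}"
    by (rule bounded_subset[rotated]) (simp add: f g test_functionD)
  then have "test_function (\<lambda>x. f x + g x)"
    using f g by (intro test_functionI C_class_add) (simp_all add: test_functionD)
  then show "u + w \<in> test_L2"
    using f g by (auto simp: test_L2_def abs_L2_add square_integrable_test)
next
  fix u :: "(real^'n) L2" and c :: real assume "u \<in> test_L2"
  then obtain f where f: "test_function f" "u = abs_L2 f"
    by (auto simp: test_L2_def)
  have "{x. c * f x \<noteq> 0} \<subseteq> {x. f x \<noteq> 0}" by auto
  then have "bounded {x. c * f x \<noteq> 0}"
    by (rule bounded_subset[rotated]) (simp add: f test_functionD)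
  then have "test_function (\<lambda>x. c * f x)"
    using f by (intro test_functionI C_class_scale) (simp_all add: test_functionD)
  then show "c *\<^sub>R u \<in> test_L2"
    using f by (auto simp: test_L2_def abs_L2_scale square_integrable_test)
qed

lemma subspace_closure:
  fixes S :: "'a::real_normed_vector set"
  assumes "subspace S" shows "subspace (closure S)"
proof (rule subspaceI)
  show "0 \<in> closure S"
    using assms closure_subset subspace_0 by blast
next
  fix x y assume "x \<in> closure S" "y \<in> closure S"
  then obtain f g where "\<And>n. f n \<in> S" "f \<longlonglongrightarrow> x" "\<And>n. g n \<in> S" "g \<longlonglongrightarrow> y"
    unfolding closure_sequential by blast
  then show "x + y \<in> closure S"
    unfolding closure_sequential using assms
    by (intro exI[of _ "\<lambda>n. f n + g n"]) (auto intro: tendsto_add subspace_add)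
next
  fix x and c :: real assume "x \<in> closure S"
  then obtain f where "\<And>n. f n \<in> S" "f \<longlonglongrightarrow> x"
    unfolding closure_sequential by blast
  then show "c *\<^sub>R x \<in> closure S"
    unfolding closure_sequential using assms
    by (intro exI[of _ "\<lambda>n. c *\<^sub>R f n"]) (auto intro: tendsto_scaleR subspace_scale)
qed

lemma square_integrable_indicator:
  assumes "A \<in> sets borel" "bounded A"
  shows "square_integrable (indicator A :: 'a::euclidean_space \<Rightarrow> real)"
  using assms by (intro square_integrable_bounded_support[where B = 1]) (auto simp: indicator_def)

text \<open>If \<open>B\<close> is smooth, positive on a box and zero elsewhere, then \<open>1 - exp (- n B)\<close> tends to the
  indicator of the box.\<close>

lemma indicator_box_in_closure_test:
  fixes a b :: "real^'n::finite"
  shows "abs_L2 (indicator (box a b)) \<in> closure test_L2"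
proof -
  define B where "B x = (\<Prod>j\<in>UNIV. flat 0 (1 * (x $ j) + - (a $ j)) * flat 0 ((-1) * (x $ j) + b $ j))" for x
  define \<psi> where "\<psi> n x = 1 + (- 1) * exp ((- real n) * B x)" for n x
  have B0: "B x = 0" if "x \<notin> box a b" for x
    using that by (force simp: B_def mem_box_cart flat_def intro!: prod_zero)
  have B1: "B x > 0" if "x \<in> box a b" for x
    using that unfolding B_def by (intro prod_pos) (auto simp: mem_box_cart flat_def)
  have Bnn: "B x \<ge> 0" for x
    using B0[of x] B1[of x] by fastforce
  have smooth: "C_class k (\<psi> n)" for k n
    unfolding \<psi>_def B_def
    by (intro C_class_add C_class_scale C_class_exp C_class_const C_class_prod C_class_mult C_class_flat)
  have "{x. \<psi> n x \<noteq> 0} \<subseteq> box a b" for n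
    using B0 by (auto simp: \<psi>_def)
  then have test: "test_function (\<psi> n)" for n
    by (intro test_functionI smooth) (rule bounded_subset[OF bounded_box])
  have "(\<lambda>n. abs_L2 (\<psi> n)) \<longlonglongrightarrow> abs_L2 (indicator (box a b))"
  proof (rule abs_L2_dominated_convergence)
    show "square_integrable (indicator (box a b) :: real^'n \<Rightarrow> real)"
      by (simp add: square_integrable_indicator)
    show "\<psi> n \<in> borel_measurable borel" for n
      using test[of n] by (simp add: borel_measurable_continuous_onI test_functionD)
    show "\<bar>\<psi> n x\<bar> \<le> \<bar>indicator (box a b) x\<bar>" for n x
      using B0[of x] Bnn[of x] by (auto simp: \<psi>_def indicator_def)
    show "(\<lambda>n. \<psi> n x) \<longlonglongrightarrow> indicator (box a b) x" for x
    proof (cases "x \<in> box a b")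
      case True
      have "exp (- B x) < 1" using B1[OF True] by simp
      then have "(\<lambda>n. 1 + (-1) * exp (- B x) ^ n) \<longlonglongrightarrow> 1 + (-1) * 0"
        by (intro tendsto_intros LIMSEQ_power_zero) simp
      then show ?thesis
        using True by (simp add: \<psi>_def exp_of_nat_mult[symmetric])
    qed (simp add: \<psi>_def B0)
  qed simp
  then show ?thesis
    unfolding closure_sequential using test
    by (intro exI[of _ "\<lambda>n. abs_L2 (\<psi> n)"]) (auto simp: test_L2_def)
qed

text \<open>Borel sets are reached from boxes by the \<open>\<pi>\<close>-\<open>\<lambda>\<close> argument; intersecting with a fixed box
  keeps all indicators square integrable.\<close>

lemma indicator_in_closure_test:
  fixes A :: "(real^'n::finite) set"
  assumes "A \<in> sets borel"
  shows "abs_L2 (indicator (A \<inter> box a b)) \<in> closure test_L2"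
proof -
  let ?G = "range (\<lambda>(a, b). box a b :: (real^'n) set)"
  have sub: "subspace (closure (test_L2 :: ((real^'n) L2) set))"
    by (rule subspace_closure[OF subspace_test_L2])
  have si: "square_integrable (indicator (A \<inter> box a b) :: real^'n \<Rightarrow> real)" if "A \<in> sets borel" for A
    using that by (intro square_integrable_indicator) (auto intro: bounded_subset[OF bounded_box])
  have borel: "sets (borel :: (real^'n) measure) = sigma_sets UNIV ?G"
    by (subst borel_eq_box) (simp add: sets_measure_of)
  have "Int_stable ?G"
    by (auto simp: Int_stable_def box_Int_box)
  moreover have "?G \<subseteq> Pow UNIV" by simp
  moreover have "A \<in> sigma_sets UNIV ?G"
    using assms borel by simp
  ultimately show ?thesis
  proof (induction rule: sigma_sets_induct_disjoint)
    case (basic A)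
    then show ?case
      by (auto simp: box_Int_box indicator_box_in_closure_test)
  next
    case empty
    show ?case
      using subspace_0[OF sub] by (simp add: zero_L2_def)
  next
    case (compl A)
    then have A: "A \<in> sets borel" using borel by simp
    have "abs_L2 (indicator (box a b)) - abs_L2 (indicator (A \<inter> box a b)) \<in> closure test_L2"
      by (intro subspace_diff[OF sub] compl indicator_box_in_closure_test)
    also have "abs_L2 (indicator (box a b)) - abs_L2 (indicator (A \<inter> box a b))
        = abs_L2 (indicator ((UNIV - A) \<inter> box a b))"
      using si[OF A] si[of UNIV]
      by (subst abs_L2_diff) (auto intro!: arg_cong[of _ _ abs_L2] simp: indicator_def)
    finally show ?case .
  next
    case (union A)
    then have A: "A i \<in> sets borel" for i using borel by auto
    have disj: "disjoint_family A" by fact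
    have "abs_L2 (indicator ((\<Union>i<n. A i) \<inter> box a b)) \<in> closure test_L2" for n
    proof (induction n)
      case 0
      show ?case
        using subspace_0[OF sub] by (simp add: zero_L2_def)
    next
      case (Suc n)
      have "abs_L2 (indicator ((\<Union>i<n. A i) \<inter> box a b)) + abs_L2 (indicator (A n \<inter> box a b)) \<in> closure test_L2"
        by (intro subspace_add[OF sub] Suc union)
      also have "abs_L2 (indicator ((\<Union>i<n. A i) \<inter> box a b)) + abs_L2 (indicator (A n \<inter> box a b))
          = abs_L2 (indicator ((\<Union>i<Suc n. A i) \<inter> box a b))"
      proof -
        have "x \<notin> A n" if "x \<in> A i" "i < n" for x i
          using disjoint_family_onD[OF disj, of i n] that by auto
        then have "(\<lambda>x. indicator ((\<Union>i<n. A i) \<inter> box a b) x + indicator (A n \<inter> box a b) x)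
            = (indicator ((\<Union>i<Suc n. A i) \<inter> box a b) :: _ \<Rightarrow> real)"
          by (auto simp: indicator_def lessThan_Suc fun_eq_iff)
        then show ?thesis
          by (subst abs_L2_add) (auto intro!: si A)
      qed
      finally show ?case .
    qed
    moreover have "(\<lambda>n. abs_L2 (indicator ((\<Union>i<n. A i) \<inter> box a b))) \<longlonglongrightarrow> abs_L2 (indicator ((\<Union>i. A i) \<inter> box a b))"
    proof (rule abs_L2_dominated_convergence)
      show "square_integrable (indicator (box a b) :: real^'n \<Rightarrow> real)"
        by (simp add: square_integrable_indicator)
      show "(\<lambda>n. indicator ((\<Union>i<n. A i) \<inter> box a b) x :: real) \<longlonglongrightarrow> indicator ((\<Union>i. A i) \<inter> box a b) x" for x
      proof (cases "\<exists>i. x \<in> A i")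
        case True
        then obtain i where "x \<in> A i" by blast
        then have "eventually (\<lambda>n. indicator ((\<Union>i<n. A i) \<inter> box a b) x = (indicator ((\<Union>i. A i) \<inter> box a b) x :: real)) sequentially"
          by (intro eventually_sequentiallyI[of "Suc i"]) (auto simp: indicator_def)
        then show ?thesis by (rule tendsto_eventually)
      qed (simp add: indicator_def)
    qed (use A in \<open>auto simp: indicator_def\<close>)
    ultimately show ?case
      by (rule closed_sequentially[OF closed_closure])
  qed
qed

theorem closure_test_L2: "closure test_L2 = (UNIV :: ((real^'n::finite) L2) set)"
proof (intro set_eqI iffI UNIV_I)
  fix u :: "(real^'n) L2"
  have sub: "subspace (closure (test_L2 :: ((real^'n) L2) set))"
    by (rule subspace_closure[OF subspace_test_L2])
  obtain s where s: "\<And>i. simple_function borel (s i)"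
      and lim: "\<And>x. (\<lambda>i. s i x) \<longlonglongrightarrow> rep_L2 u x"
      and bound: "\<And>i x. \<bar>s i x\<bar> \<le> 2 * \<bar>rep_L2 u x\<bar>"
    using borel_measurable_implies_sequence_metric[OF borel_rep[of u], of 0] by (auto simp: dist_norm)
  \<comment> \<open>Cutting off by the boxes \<open>K i\<close> makes the level sets of the simple functions bounded.\<close>
  define K where "K i = (box (- (\<chi> j. real i)) (\<chi> j. real i) :: (real^'n) set)" for i
  have sm [measurable]: "s i \<in> borel_measurable borel" for i
    using s by (rule borel_measurable_simple_function)
  have mem: "abs_L2 (\<lambda>x. s i x * indicator (K i) x) \<in> closure test_L2" for i
  proof -
    let ?A = "\<lambda>y. s i -` {y}"
    have fin: "finite (range (s i))"
      using s[of i] by (simp add: simple_function_def)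
    have A: "?A y \<in> sets borel" for y
      using measurable_sets[OF sm[of i], of "{y}"] by simp
    have si: "square_integrable (\<lambda>x. y * indicator (?A y \<inter> K i) x :: real)" for y
      using A by (intro square_integrable_scale square_integrable_indicator)
        (auto simp: K_def intro: bounded_subset[OF bounded_box])
    define t where "t y x = y * indicator (?A y \<inter> K i) x" for y x
    have "square_integrable (\<lambda>x. \<Sum>y\<in>Y. t y x) \<and>
        abs_L2 (\<lambda>x. \<Sum>y\<in>Y. t y x) \<in> closure test_L2" if "finite Y" for Y
      using that
    proof induction
      case empty
      then show ?case
        using subspace_0[OF sub] by (simp add: square_integrable_zero zero_L2_def)
    next
      case (insert y Y)
      have "abs_L2 (t y) \<in> closure test_L2"
        unfolding t_def using subspace_scale[OF sub indicator_in_closure_test[OF A], of y y] A unfolding K_def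
        by (subst abs_L2_scale[symmetric])
           (auto intro!: square_integrable_indicator intro: bounded_subset[OF bounded_box])
      moreover have "square_integrable (t y)"
        unfolding t_def by (rule si)
      ultimately show ?case
        using insert subspace_add[OF sub] by (simp add: square_integrable_add abs_L2_add[symmetric])
    qed
    from this[OF fin]
    have "abs_L2 (\<lambda>x. \<Sum>y\<in>range (s i). t y x) \<in> closure test_L2" ..
    also have "(\<lambda>x. \<Sum>y\<in>range (s i). t y x) = (\<lambda>x. s i x * indicator (K i) x)"
    proof
      fix x
      have "(\<Sum>y\<in>range (s i). t y x)
          = (\<Sum>y\<in>range (s i). if y = s i x then s i x * indicator (K i) x else 0)"
        by (intro sum.cong) (auto simp: t_def indicator_def)
      then show "(\<Sum>y\<in>range (s i). t y x) = s i x * indicator (K i) x"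
        using fin by simp
    qed
    finally show ?thesis .
  qed
  have "(\<lambda>i. abs_L2 (\<lambda>x. s i x * indicator (K i) x)) \<longlonglongrightarrow> abs_L2 (rep_L2 u)"
  proof (rule abs_L2_dominated_convergence)
    show "square_integrable (\<lambda>x. 2 * rep_L2 u x)"
      by (rule square_integrable_scale[OF square_integrable_rep])
    show "(\<lambda>x. s i x * indicator (K i) x) \<in> borel_measurable borel" for i
      unfolding K_def by measurable
    show "\<bar>s i x * indicator (K i) x\<bar> \<le> \<bar>2 * rep_L2 u x\<bar>" for i x
      using bound[of i x] by (auto simp: indicator_def abs_mult)
    show "(\<lambda>i. s i x * indicator (K i) x) \<longlonglongrightarrow> rep_L2 u x" for x
    proof (rule Lim_transform_eventually[OF lim])
      obtain N :: nat where N: "norm x < N"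
        using reals_Archimedean2 by blast
      have "x \<in> K i" if "i \<ge> N" for i
        unfolding K_def mem_box_cart
      proof (intro allI)
        fix j
        have "\<bar>x $ j\<bar> < real i"
          using component_le_norm_cart[of x j] N that by linarith
        then show "(- (\<chi> j. real i)) $ j < x $ j \<and> x $ j < (\<chi> j. real i) $ j"
          by (simp add: abs_less_iff)
      qed
      then show "eventually (\<lambda>i. s i x = s i x * indicator (K i) x) sequentially"
        by (intro eventually_sequentiallyI[of N]) simp
    qed
  qed simp
  with mem have "abs_L2 (rep_L2 u) \<in> closure test_L2"
    by (rule closed_sequentially[OF closed_closure])
  then show "u \<in> closure test_L2"
    by (simp add: abs_rep_L2)
qed

section \<open>Difference quotients\<close>

text \<open>Continuously differentiable functions with bounded support.\<close>

definition C1_bounded_support :: "(real^'n::finite \<Rightarrow> real) \<Rightarrow> bool" where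
  "C1_bounded_support f \<longleftrightarrow> C_class 1 f \<and> bounded {x. f x \<noteq> 0}"

lemma C1_bounded_supportD:
  assumes "C1_bounded_support f"
  shows "f differentiable_on UNIV" "continuous_on UNIV (partial i f)"
    "continuous_on UNIV f" "bounded {x. f x \<noteq> 0}"
  using assms by (auto simp: C1_bounded_support_def intro: differentiable_imp_continuous_on)

lemma test_function_C1: "test_function \<psi> \<Longrightarrow> C1_bounded_support \<psi>"
  by (simp add: C1_bounded_support_def test_functionD del: C_class.simps)

lemma partial_support:
  "{x. partial i f x \<noteq> 0} \<subseteq> closure {x. f x \<noteq> 0}"
proof
  fix x assume x: "x \<in> {x. partial i f x \<noteq> 0}"
  show "x \<in> closure {x. f x \<noteq> 0}"
  proof (rule ccontr)
    let ?U = "- closure {x. f x \<noteq> 0}"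
    assume "x \<notin> closure {x. f x \<noteq> 0}"
    then have "x \<in> ?U" by simp
    have f0: "0 = f y" if "y \<in> ?U" for y
      using that closure_subset[of "{x. f x \<noteq> 0}"] by auto
    have "open ?U" by (rule open_Compl[OF closed_closure])
    from has_derivative_transform_within_open[OF has_derivative_const[of 0] this \<open>x \<in> ?U\<close> f0]
    have "(f has_derivative (\<lambda>_. 0)) (at x)" .
    from partial_eq[OF this] show False
      using x by simp
  qed
qed

lemma partial_bounded_support:
  "bounded {x. f x \<noteq> 0} \<Longrightarrow> bounded {x. partial i f x \<noteq> 0}"
  by (rule bounded_subset[OF _ partial_support]) (rule bounded_closure)

lemma square_integrable_C1:
  assumes "C1_bounded_support f"
  shows "square_integrable f" "square_integrable (partial i f)"
  using C1_bounded_supportD[OF assms] partial_bounded_support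
  by (auto intro!: square_integrable_continuous)

lemma has_derivative_translation:
  assumes "f differentiable_on UNIV"
  shows "((\<lambda>x. f (x + h)) has_derivative frechet_derivative f (at (x + h))) (at x)"
proof -
  have "((\<lambda>x. x + h) has_derivative (\<lambda>v. v)) (at x)"
    by (auto intro!: derivative_eq_intros)
  from has_derivative_compose[OF this has_derivative_frechet[OF assms]] show ?thesis by simp
qed

lemma partial_translation:
  assumes "f differentiable_on UNIV"
  shows "partial i (\<lambda>x. f (x + h)) = (\<lambda>x. partial i f (x + h))"
  by (rule ext, rule partial_eq[OF has_derivative_translation[OF assms], THEN trans])
     (simp add: partial_def)

lemma C_class_translation: "C_class k f \<Longrightarrow> C_class k (\<lambda>x. f (x + h))"
proof (induction k arbitrary: f)
  case 0
  then have "continuous_on UNIV (f \<circ> (\<lambda>x. x + h))"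
    by (intro continuous_on_compose continuous_intros) (auto intro: continuous_on_subset)
  then show ?case by (simp add: o_def)
next
  case (Suc k)
  then have f: "f differentiable_on UNIV" by simp
  have "(\<lambda>x. f (x + h)) differentiable_on UNIV"
    using has_derivative_translation[OF f] unfolding differentiable_on_def differentiable_def by blast
  with Suc f show ?case
    by (simp add: partial_translation)
qed

lemma bounded_support_translation:
  fixes f :: "'a::real_normed_vector \<Rightarrow> real"
  assumes "bounded {x. f x \<noteq> 0}"
  shows "bounded {x. f (x + h) \<noteq> 0}"
proof -
  have "{x. f (x + h) \<noteq> 0} \<subseteq> (\<lambda>x. - h + x) ` {x. f x \<noteq> 0}"
  proof
    fix x assume "x \<in> {x. f (x + h) \<noteq> 0}"
    then show "x \<in> (\<lambda>x. - h + x) ` {x. f x \<noteq> 0}"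
      by (intro image_eqI[of _ _ "x + h"]) auto
  qed
  then show ?thesis
    by (rule bounded_subset[OF bounded_translation[OF assms]])
qed

lemma test_function_translation: "test_function \<psi> \<Longrightarrow> test_function (\<lambda>x. \<psi> (x + h))"
  by (intro test_functionI C_class_translation bounded_support_translation) (auto intro: test_functionD)

lemma directional_derivative:
  fixes f :: "real^'n::finite \<Rightarrow> real"
  assumes "f differentiable_on UNIV"
  shows "((\<lambda>s. f (x + s *\<^sub>R axis i 1)) has_real_derivative partial i f (x + s *\<^sub>R axis i 1)) (at s)"
proof -
  have "((\<lambda>s. x + s *\<^sub>R axis i (1::real)) has_derivative (\<lambda>t. t *\<^sub>R axis i 1)) (at s)"
    by (auto intro!: derivative_eq_intros)
  from has_derivative_compose[OF this has_derivative_frechet[OF assms]]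
  have "((\<lambda>s. f (x + s *\<^sub>R axis i 1)) has_derivative
      (\<lambda>t. frechet_derivative f (at (x + s *\<^sub>R axis i 1)) (t *\<^sub>R axis i 1))) (at s)" .
  moreover have "frechet_derivative f (at y) (t *\<^sub>R axis i 1) = partial i f y * t" for t y
  proof -
    have "f differentiable at y"
      using assms by (auto simp: differentiable_on_def)
    from linear_scale[OF linear_frechet_derivative[OF this], of t "axis i 1"]
    show ?thesis
      by (simp only: partial_def real_scaleR_def mult.commute)
  qed
  ultimately show ?thesis
    by (simp add: has_field_derivative_def)
qed

text \<open>Difference quotients of such a function converge weakly in \<open>L\<^sup>2\<close>: they are bounded and their
  supports stay in a fixed ball, so dominated convergence applies.\<close>

lemma inner_difference_quotient_C1:
  fixes f :: "real^'n::finite \<Rightarrow> real"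
  assumes f: "C1_bounded_support f"
  shows "((\<lambda>s. (inner u (translate_L2 (s *\<^sub>R axis i 1) (abs_L2 f)) - inner u (abs_L2 f)) / s)
           \<longlongrightarrow> inner u (abs_L2 (partial i f))) (at 0)"
proof -
  let ?e = "axis i 1 :: real^'n"
  have sf: "square_integrable f" and sp: "square_integrable (partial i f)"
    using square_integrable_C1[OF f] by auto
  have [measurable]: "f \<in> borel_measurable borel" "partial i f \<in> borel_measurable borel"
    using sf sp by (auto simp: square_integrable_def)
  obtain B where B: "\<And>x. \<bar>partial i f x\<bar> \<le> B"
    using continuous_bounded_support_bounded partial_bounded_support C1_bounded_supportD[OF f] by metis
  obtain R where R: "\<And>x. f x \<noteq> 0 \<Longrightarrow> norm x \<le> R"
    using C1_bounded_supportD(4)[OF f] by (auto simp: bounded_iff)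
  define q where "q s x = (f (x + s *\<^sub>R ?e) - f x) / s" for s x
  define K where "K = cball (0 :: real^'n) (R + 1)"
  have siK: "square_integrable (indicator K :: real^'n \<Rightarrow> real)"
    unfolding K_def by (intro square_integrable_indicator) auto
  have qB: "\<bar>q s x\<bar> \<le> B * indicator K x" if s: "s \<noteq> 0" "\<bar>s\<bar> \<le> 1" for s x
  proof (cases "x \<in> K")
    case True
    have "norm (f (x + s *\<^sub>R ?e) - f (x + 0 *\<^sub>R ?e)) \<le> B * norm (s - 0)"
      using B by (intro field_differentiable_bound[where S = UNIV
            and f' = "\<lambda>s. partial i f (x + s *\<^sub>R ?e)"])
        (auto intro: directional_derivative[OF C1_bounded_supportD(1)[OF f]])
    then show ?thesis
      using True s by (simp add: q_def field_simps)
  next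
    case False
    then have "norm x > R + 1" by (simp add: K_def)
    moreover have "norm x \<le> norm (x + s *\<^sub>R ?e) + norm (s *\<^sub>R ?e)"
      using norm_triangle_ineq4[of "x + s *\<^sub>R ?e" "s *\<^sub>R ?e"] by simp
    ultimately have "\<not> norm x \<le> R" "\<not> norm (x + s *\<^sub>R ?e) \<le> R"
      using s by (auto simp: norm_axis_1)
    then have "f x = 0" "f (x + s *\<^sub>R ?e) = 0"
      using R by blast+
    then show ?thesis using False by (simp add: q_def)
  qed
  have eq: "(inner u (translate_L2 (s *\<^sub>R ?e) (abs_L2 f)) - inner u (abs_L2 f)) / s
      = (\<integral>x. rep_L2 u x * q s x \<partial>lborel)" for s
  proof -
    have st: "square_integrable (\<lambda>x. f (x + s *\<^sub>R ?e))"
      by (rule square_integrable_translation[OF sf])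
    have "inner u (translate_L2 (s *\<^sub>R ?e) (abs_L2 f)) - inner u (abs_L2 f)
        = (\<integral>x. rep_L2 u x * (f (x + s *\<^sub>R ?e) - f x) \<partial>lborel)"
      using inner_abs_L2[OF square_integrable_diff[OF st sf], of u]
      by (simp add: translate_abs_L2[OF sf] inner_diff_right[symmetric] abs_L2_diff[OF st sf])
    then show ?thesis by (simp add: q_def)
  qed
  show ?thesis
    unfolding eq inner_abs_L2[OF sp]
  proof (subst tendsto_at_iff_sequentially, intro allI impI, unfold o_def)
    fix X :: "nat \<Rightarrow> real"
    assume X0: "\<forall>n. X n \<in> UNIV - {0}" and X: "X \<longlonglongrightarrow> 0"
    have "eventually (\<lambda>n. \<bar>X n\<bar> < 1) sequentially"
      using X by (auto simp: tendsto_iff dist_real_def)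
    then obtain N where N: "\<And>n. n \<ge> N \<Longrightarrow> \<bar>X n\<bar> < 1"
      by (auto simp: eventually_sequentially)
    have "(\<lambda>n. \<integral>x. rep_L2 u x * q (X (n + N)) x \<partial>lborel) \<longlonglongrightarrow> (\<integral>x. rep_L2 u x * partial i f x \<partial>lborel)"
    proof (rule integral_dominated_convergence)
      show "integrable lborel (\<lambda>x. \<bar>rep_L2 u x * (B * indicator K x)\<bar>)"
        by (intro integrable_abs square_integrable_mult square_integrable_rep square_integrable_scale siK)
      show "(\<lambda>x. rep_L2 u x * q (X (n + N)) x) \<in> borel_measurable lborel" for n
        unfolding q_def by measurable
      show "AE x in lborel. (\<lambda>n. rep_L2 u x * q (X (n + N)) x) \<longlonglongrightarrow> rep_L2 u x * partial i f x"
      proof (intro always_eventually allI tendsto_mult tendsto_const)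
        fix x
        have "((\<lambda>s. q s x) \<longlongrightarrow> partial i f x) (at 0)"
          using directional_derivative[OF C1_bounded_supportD(1)[OF f], of x i 0]
          by (simp add: has_field_derivative_iff q_def)
        moreover have "filterlim (\<lambda>n. X (n + N)) (at 0) sequentially"
          using X X0 by (auto simp: filterlim_at LIMSEQ_ignore_initial_segment)
        ultimately show "(\<lambda>n. q (X (n + N)) x) \<longlonglongrightarrow> partial i f x"
          by (rule filterlim_compose)
      qed
      show "AE x in lborel. norm (rep_L2 u x * q (X (n + N)) x) \<le> \<bar>rep_L2 u x * (B * indicator K x)\<bar>" for n
      proof (intro always_eventually allI)
        fix x
        have "\<bar>q (X (n + N)) x\<bar> \<le> \<bar>B * indicator K x\<bar>"
          using qB[of "X (n + N)" x] X0 N[of "n + N"] by force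
        then show "norm (rep_L2 u x * q (X (n + N)) x) \<le> \<bar>rep_L2 u x * (B * indicator K x)\<bar>"
          unfolding real_norm_def abs_mult[of "rep_L2 u x"] by (rule mult_left_mono) simp
      qed
    qed simp
    then show "(\<lambda>n. \<integral>x. rep_L2 u x * q (X n) x \<partial>lborel) \<longlonglongrightarrow> (\<integral>x. rep_L2 u x * partial i f x \<partial>lborel)"
      by (rule LIMSEQ_offset)
  qed
qed

section \<open>Weak derivatives\<close>

lemma has_weak_partial_inner:
  "has_weak_partial u i w \<longleftrightarrow>
     (\<forall>\<psi>. test_function \<psi> \<longrightarrow> inner u (abs_L2 (partial i \<psi>)) = - inner w (abs_L2 \<psi>))"
  unfolding has_weak_partial_def
  by (intro all_cong1 imp_cong refl) (simp add: inner_abs_L2 square_integrable_C1[OF test_function_C1])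

lemma test_approximation:
  fixes f :: "(real^'n::finite) L2"
  assumes "e > 0"
  obtains \<psi> where "test_function \<psi>" "norm (f - abs_L2 \<psi>) < e"
proof -
  have "f \<in> closure test_L2"
    by (simp add: closure_test_L2)
  then obtain y where "y \<in> test_L2" "dist y f < e"
    using assms by (auto simp: closure_approachable)
  then show ?thesis
    using that by (auto simp: test_L2_def dist_norm norm_minus_commute)
qed

context
  fixes u w :: "(real^'n::finite) L2" and i :: 'n
  assumes uw: "has_weak_partial u i w"
begin

lemma translation_derivative_test:
  assumes \<psi>: "test_function \<psi>"
  shows "((\<lambda>s. inner u (translate_L2 (s *\<^sub>R axis i 1) (abs_L2 \<psi>))) has_real_derivative
      - inner w (translate_L2 (s *\<^sub>R axis i 1) (abs_L2 \<psi>))) (at s)"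
proof -
  let ?e = "axis i 1 :: real^'n"
  let ?\<psi> = "\<lambda>x. \<psi> (x + s *\<^sub>R ?e)"
  have t: "test_function ?\<psi>"
    by (rule test_function_translation[OF \<psi>])
  have abs: "translate_L2 (s *\<^sub>R ?e) (abs_L2 \<psi>) = abs_L2 ?\<psi>"
    by (rule translate_abs_L2[OF square_integrable_test[OF \<psi>]])
  have "translate_L2 ((s + h) *\<^sub>R ?e) (abs_L2 \<psi>) = translate_L2 (h *\<^sub>R ?e) (abs_L2 ?\<psi>)" for h
    by (simp add: abs[symmetric] translate_L2_translate scaleR_add_left add.commute)
  moreover have "((\<lambda>h. (inner u (translate_L2 (h *\<^sub>R ?e) (abs_L2 ?\<psi>)) - inner u (abs_L2 ?\<psi>)) / h)
      \<longlongrightarrow> - inner w (abs_L2 ?\<psi>)) (at 0)"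
    using inner_difference_quotient_C1[OF test_function_C1[OF t], of u i] uw t
    by (simp add: has_weak_partial_inner)
  ultimately show ?thesis
    by (simp add: DERIV_def abs)
qed

text \<open>By the mean value theorem, since the derivative just found is at most \<open>\<parallel>w\<parallel> \<parallel>\<psi>\<parallel>\<close> in modulus.\<close>

lemma translation_difference_bound_test:
  assumes \<psi>: "test_function \<psi>"
  shows "\<bar>inner u (translate_L2 (s *\<^sub>R axis i 1) (abs_L2 \<psi>)) - inner u (abs_L2 \<psi>)\<bar>
      \<le> \<bar>s\<bar> * norm w * norm (abs_L2 \<psi>)"
proof -
  let ?g = "\<lambda>s. inner u (translate_L2 (s *\<^sub>R axis i 1) (abs_L2 \<psi>))"
  have "norm (?g s - ?g 0) \<le> (norm w * norm (abs_L2 \<psi>)) * norm (s - 0)"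
  proof (rule field_differentiable_bound[where S = UNIV
        and f' = "\<lambda>s. - inner w (translate_L2 (s *\<^sub>R axis i 1) (abs_L2 \<psi>))"])
    show "norm (- inner w (translate_L2 (s *\<^sub>R axis i 1) (abs_L2 \<psi>))) \<le> norm w * norm (abs_L2 \<psi>)" for s
      using Cauchy_Schwarz_ineq2[of w "translate_L2 (s *\<^sub>R axis i 1) (abs_L2 \<psi>)"]
      by (simp add: norm_translate_L2)
  qed (auto intro: translation_derivative_test[OF \<psi>])
  then show ?thesis
    by (simp add: translate_L2_zero mult_ac)
qed

lemma translation_difference_bound:
  "\<bar>inner u (translate_L2 (s *\<^sub>R axis i 1) f) - inner u f\<bar> \<le> \<bar>s\<bar> * norm w * norm f"
proof -
  let ?\<tau> = "translate_L2 (s *\<^sub>R axis i 1)"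
  have bl: "bounded_linear ?\<tau>"
    by (rule bounded_linear_intro[where K = 1])
       (auto simp: translate_L2_add translate_L2_scaleR norm_translate_L2)
  let ?S = "{f. \<bar>inner u (?\<tau> f) - inner u f\<bar> \<le> \<bar>s\<bar> * norm w * norm f}"
  have "closed ?S"
    by (intro closed_Collect_le continuous_intros bounded_linear.continuous_on[OF bl])
  moreover have "test_L2 \<subseteq> ?S"
    using translation_difference_bound_test by (auto simp: test_L2_def)
  ultimately have "closure test_L2 \<subseteq> ?S"
    by (rule closure_minimal[rotated])
  then show ?thesis
    by (auto simp: closure_test_L2)
qed

text \<open>The difference quotients of \<open>u\<close>, moved here to the other factor, converge weakly to its weak
  derivative.  They are uniformly bounded by the preceding estimate, so convergence on the test
  functions is enough.\<close>

lemma inner_difference_quotient_weak: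
  "((\<lambda>s. (inner u (translate_L2 (s *\<^sub>R axis i 1) f) - inner u f) / s) \<longlongrightarrow> - inner w f) (at 0)"
proof (rule tendstoI)
  fix e :: real assume e: "e > 0"
  let ?d = "\<lambda>s f. (inner u (translate_L2 (s *\<^sub>R axis i 1) f) - inner u f) / s"
  define M where "M = 2 * (norm w + 1)"
  have M: "M > 0" by (simp add: M_def add_nonneg_pos)
  obtain \<psi> where \<psi>: "test_function \<psi>" "norm (f - abs_L2 \<psi>) < e / (2 * M)"
    using test_approximation[of "e / (2 * M)" f] e M by auto
  let ?r = "f - abs_L2 \<psi>"
  have "((\<lambda>s. ?d s (abs_L2 \<psi>)) \<longlongrightarrow> - inner w (abs_L2 \<psi>)) (at 0)"
    using translation_derivative_test[OF \<psi>(1), of 0] by (simp add: DERIV_def translate_L2_zero)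
  then have "eventually (\<lambda>s. dist (?d s (abs_L2 \<psi>)) (- inner w (abs_L2 \<psi>)) < e / 2) (at 0)"
    using e by (intro tendstoD) auto
  moreover have "eventually (\<lambda>s. s \<noteq> 0) (at (0::real))"
    by (simp add: eventually_at_filter)
  ultimately show "eventually (\<lambda>s. dist (?d s f) (- inner w f) < e) (at 0)"
  proof eventually_elim
    case (elim s)
    have "\<bar>?d s ?r\<bar> \<le> norm w * norm ?r"
      using translation_difference_bound[of s ?r] elim by (simp add: divide_le_eq mult_ac)
    moreover have "\<bar>inner w ?r\<bar> \<le> norm w * norm ?r"
      by (rule Cauchy_Schwarz_ineq2)
    moreover have "2 * (norm w * norm ?r) \<le> M * norm ?r"
      by (simp add: M_def algebra_simps)
    moreover have "M * norm ?r < e / 2"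
      using \<psi>(2) M by (simp add: field_simps)
    moreover have "?d s f - (- inner w f) = (?d s (abs_L2 \<psi>) - (- inner w (abs_L2 \<psi>))) + ?d s ?r + inner w ?r"
      by (simp add: translate_L2_diff inner_diff_right diff_divide_distrib)
    ultimately show ?case
      using elim unfolding dist_real_def by linarith
  qed
qed

end

text \<open>The same difference quotient, read once as acting on \<open>w\<close> and once, after a translation of the
  integral, as acting on \<open>u\<close>, has the two limits that are to be identified.\<close>

theorem weak_integration_by_parts:
  assumes u: "has_weak_partial u i u'" and w: "has_weak_partial w i w'"
  shows "inner u' w = - inner u w'"
proof -
  let ?e = "axis i 1"
  have "((\<lambda>s. (inner u (translate_L2 (s *\<^sub>R ?e) w) - inner u w) / s) \<longlongrightarrow> - inner u' w) (at 0)"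
    by (rule inner_difference_quotient_weak[OF u])
  moreover have "((\<lambda>s. (inner u (translate_L2 (s *\<^sub>R ?e) w) - inner u w) / s) \<longlongrightarrow> - (- inner w' u)) (at 0)"
  proof -
    have "filterlim (\<lambda>s. - s) (at 0) (at (0::real))"
      by (auto simp: filterlim_at eventually_at_filter intro!: tendsto_eq_intros)
    from tendsto_minus[OF filterlim_compose[OF inner_difference_quotient_weak[OF w, of u] this]]
    have "((\<lambda>s. - ((inner w (translate_L2 ((- s) *\<^sub>R ?e) u) - inner w u) / (- s))) \<longlongrightarrow> - (- inner w' u)) (at 0)" .
    moreover have "inner w (translate_L2 ((- s) *\<^sub>R ?e) u) = inner u (translate_L2 (s *\<^sub>R ?e) w)" for s
      using inner_translate_left[of "s *\<^sub>R ?e" w u] by (simp add: inner_commute)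
    ultimately show ?thesis
      by (simp add: inner_commute)
  qed
  ultimately have "- inner u' w = - (- inner w' u)"
    by (rule tendsto_unique[rotated]) simp
  then show ?thesis
    by (simp add: inner_commute)
qed

lemma has_weak_partial_C1:
  fixes f :: "real^'n::finite \<Rightarrow> real"
  assumes f: "C1_bounded_support f"
  shows "has_weak_partial (abs_L2 f) i (abs_L2 (partial i f))"
  unfolding has_weak_partial_inner
proof (intro allI impI)
  fix \<psi> :: "real^'n \<Rightarrow> real" assume \<psi>: "test_function \<psi>"
  let ?e = "axis i 1" and ?f = "abs_L2 f" and ?\<psi> = "abs_L2 \<psi>"
  have "((\<lambda>s. (inner ?f (translate_L2 (s *\<^sub>R ?e) ?\<psi>) - inner ?f ?\<psi>) / s) \<longlongrightarrow> inner ?f (abs_L2 (partial i \<psi>))) (at 0)"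
    by (rule inner_difference_quotient_C1[OF test_function_C1[OF \<psi>]])
  moreover have "((\<lambda>s. (inner ?f (translate_L2 (s *\<^sub>R ?e) ?\<psi>) - inner ?f ?\<psi>) / s) \<longlongrightarrow> - inner ?\<psi> (abs_L2 (partial i f))) (at 0)"
  proof -
    have "filterlim (\<lambda>s. - s) (at 0) (at (0::real))"
      by (auto simp: filterlim_at eventually_at_filter intro!: tendsto_eq_intros)
    from tendsto_minus[OF filterlim_compose[OF inner_difference_quotient_C1[OF f, of ?\<psi> i] this]]
    have "((\<lambda>s. - ((inner ?\<psi> (translate_L2 ((- s) *\<^sub>R ?e) ?f) - inner ?\<psi> ?f) / (- s)))
        \<longlongrightarrow> - inner ?\<psi> (abs_L2 (partial i f))) (at 0)" .
    moreover have "inner ?\<psi> (translate_L2 ((- s) *\<^sub>R ?e) ?f) = inner ?f (translate_L2 (s *\<^sub>R ?e) ?\<psi>)" for s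
      using inner_translate_left[of "s *\<^sub>R ?e" ?\<psi> ?f] by (simp add: inner_commute)
    ultimately show ?thesis
      by (simp add: inner_commute)
  qed
  ultimately have "inner ?f (abs_L2 (partial i \<psi>)) = - inner ?\<psi> (abs_L2 (partial i f))"
    by (rule tendsto_unique[rotated]) simp
  then show "inner ?f (abs_L2 (partial i \<psi>)) = - inner (abs_L2 (partial i f)) ?\<psi>"
    by (simp add: inner_commute)
qed

lemma has_weak_partial_add:
  "has_weak_partial u i u' \<Longrightarrow> has_weak_partial w i w' \<Longrightarrow> has_weak_partial (u + w) i (u' + w')"
  by (simp add: has_weak_partial_inner inner_add_left)

lemma has_weak_partial_zero: "has_weak_partial 0 i 0"
  by (simp add: has_weak_partial_inner)

lemma has_weak_partial_sum:
  "(\<And>k. k \<in> K \<Longrightarrow> has_weak_partial (u k) i (u' k)) \<Longrightarrow> has_weak_partial (\<Sum>k\<in>K. u k) i (\<Sum>k\<in>K. u' k)"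
  by (induction K rule: infinite_finite_induct) (auto intro: has_weak_partial_add has_weak_partial_zero)

lemma BC_class_1_multiplier:
  assumes "BC_class 1 m"
  shows "L2_multiplier m" "L2_multiplier (partial i m)"
  using assms by (auto simp: L2_multiplier_def intro!: borel_measurable_continuous_onI
      intro: differentiable_imp_continuous_on)

text \<open>The product rule for a \<open>C\<^sup>1\<close> factor with bounded derivatives.  Testing with \<open>\<psi>\<close> means integrating by parts against \<open>m \<psi>\<close>, which is only
  once continuously differentiable.\<close>

lemma has_weak_partial_mult:
  fixes m :: "real^'n::finite \<Rightarrow> real"
  assumes m: "BC_class 1 m" and u: "has_weak_partial u i u'"
  shows "has_weak_partial (mult_L2 m u) i (mult_L2 m u' + mult_L2 (partial i m) u)"
  unfolding has_weak_partial_inner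
proof (intro allI impI)
  fix \<psi> :: "real^'n \<Rightarrow> real" assume \<psi>: "test_function \<psi>"
  note mult = BC_class_1_multiplier[OF m]
  have C1: "C1_bounded_support \<psi>"
    by (rule test_function_C1[OF \<psi>])
  have diff: "m differentiable_on UNIV" "\<psi> differentiable_on UNIV"
    using m C1_bounded_supportD[OF C1] by auto
  have "bounded {x. m x * \<psi> x \<noteq> 0}"
    by (rule bounded_subset[OF test_functionD(3)[OF \<psi>]]) auto
  then have "C1_bounded_support (\<lambda>x. m x * \<psi> x)"
    using m C1 C_class_mult[of 1 m \<psi>] by (auto simp: C1_bounded_support_def)
  note W = has_weak_partial_C1[OF this, of i]
  have si: "square_integrable \<psi>" "square_integrable (partial i \<psi>)"
    using square_integrable_C1[OF C1] by auto
  have "abs_L2 (\<lambda>x. m x * \<psi> x) = mult_L2 m (abs_L2 \<psi>)"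
    by (rule mult_L2_abs[OF mult(1) si(1), symmetric])
  moreover have "abs_L2 (partial i (\<lambda>x. m x * \<psi> x))
      = mult_L2 m (abs_L2 (partial i \<psi>)) + mult_L2 (partial i m) (abs_L2 \<psi>)"
    using mult by (simp add: partial_mult[OF diff] mult_L2_abs si abs_L2_add L2_multiplier_def
        square_integrable_mult_bounded)
  ultimately have "inner u' (mult_L2 m (abs_L2 \<psi>))
      = - inner u (mult_L2 m (abs_L2 (partial i \<psi>)) + mult_L2 (partial i m) (abs_L2 \<psi>))"
    using weak_integration_by_parts[OF u W] by simp
  then show "inner (mult_L2 m u) (abs_L2 (partial i \<psi>))
      = - inner (mult_L2 m u' + mult_L2 (partial i m) u) (abs_L2 \<psi>)"
    by (simp add: inner_add_left inner_add_right inner_mult_L2_commute mult)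
qed

section \<open>Weak convergence of bounded sequences with vanishing derivative\<close>

text \<open>Translates of \<open>\<psi>\<close> by distinct multiples of \<open>2 R\<close> have disjoint supports and are orthogonal.\<close>

lemma norm_sum_disjoint_translates:
  fixes \<psi> :: "real^'n::finite \<Rightarrow> real"
  assumes \<psi>: "square_integrable \<psi>" and R: "\<And>x. \<psi> x \<noteq> 0 \<Longrightarrow> norm x < R"
  shows "(norm (\<Sum>k<N. translate_L2 ((2 * R * real k) *\<^sub>R axis i 1) (abs_L2 \<psi>)))\<^sup>2
      = real N * (norm (abs_L2 \<psi>))\<^sup>2"
proof -
  let ?e = "axis i 1 :: real^'n"
  let ?t = "\<lambda>k. translate_L2 ((2 * R * real k) *\<^sub>R ?e) (abs_L2 \<psi>)"
  have zero: "\<psi> (x + (2 * R * real k) *\<^sub>R ?e) * \<psi> (x + (2 * R * real l) *\<^sub>R ?e) = 0" if "k \<noteq> l" for k l x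
  proof (rule ccontr)
    assume "\<not> ?thesis"
    then have n: "norm (x + (2 * R * real k) *\<^sub>R ?e) < R" "norm (x + (2 * R * real l) *\<^sub>R ?e) < R"
      using R by auto
    have "(x + (2 * R * real k) *\<^sub>R ?e) - (x + (2 * R * real l) *\<^sub>R ?e) = (2 * R * (real k - real l)) *\<^sub>R ?e"
      by (simp add: algebra_simps)
    then have "norm ((2 * R * (real k - real l)) *\<^sub>R ?e) < 2 * R"
      using norm_triangle_ineq4[of "x + (2 * R * real k) *\<^sub>R ?e" "x + (2 * R * real l) *\<^sub>R ?e"] n by simp
    moreover have "R > 0"
      using n norm_ge_zero order.strict_trans1 by blast
    moreover have "\<bar>real k - real l\<bar> \<ge> 1"
      using that by linarith
    ultimately show False
      by (simp add: norm_axis_1 abs_mult)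
  qed
  have "orthogonal (?t k) (?t l)" if "k \<noteq> l" for k l
  proof -
    have "orthogonal (?t k) (?t l) \<longleftrightarrow> inner (?t k) (abs_L2 (\<lambda>x. \<psi> (x + (2 * R * real l) *\<^sub>R ?e))) = 0"
      by (simp add: orthogonal_def translate_abs_L2 \<psi>)
    also have "inner (?t k) (abs_L2 (\<lambda>x. \<psi> (x + (2 * R * real l) *\<^sub>R ?e)))
        = (\<integral>x. rep_L2 (?t k) x * \<psi> (x + (2 * R * real l) *\<^sub>R ?e) \<partial>lborel)"
      by (rule inner_abs_L2[OF square_integrable_translation[OF \<psi>]])
    also have "\<dots> = (\<integral>x. 0 \<partial>(lborel :: (real^'n) measure))"
    proof (rule integral_cong_AE)
      have [measurable]: "\<psi> \<in> borel_measurable borel"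
        using \<psi> by (simp add: square_integrable_def)
      show "(\<lambda>x. rep_L2 (?t k) x * \<psi> (x + (2 * R * real l) *\<^sub>R ?e)) \<in> borel_measurable lborel"
        by measurable
      show "AE x in lborel. rep_L2 (?t k) x * \<psi> (x + (2 * R * real l) *\<^sub>R ?e) = 0"
        using rep_abs_L2_AE[OF square_integrable_translation[OF \<psi>, of "(2 * R * real k) *\<^sub>R ?e"]]
        unfolding translate_abs_L2[OF \<psi>]
      proof eventually_elim
        case (elim x)
        show ?case unfolding elim by (rule zero[OF that])
      qed
    qed simp
    finally show ?thesis by simp
  qed
  then have "(norm (\<Sum>k<N. ?t k))\<^sup>2 = (\<Sum>k<N. (norm (?t k))\<^sup>2)"
    by (intro norm_sum_Pythagorean) (auto simp: pairwise_def)
  then show ?thesis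
    by (simp add: norm_translate_L2)
qed

lemma weakly_null_test:
  fixes u w :: "nat \<Rightarrow> (real^'n::finite) L2"
  assumes wp: "\<And>n. has_weak_partial (u n) i (w n)"
    and bound: "\<And>n. norm (u n) \<le> M"
    and w: "(\<lambda>n. norm (w n)) \<longlonglongrightarrow> 0"
    and \<psi>: "test_function \<psi>"
  shows "(\<lambda>n. inner (u n) (abs_L2 \<psi>)) \<longlonglongrightarrow> 0"
proof (rule LIMSEQ_I)
  fix \<epsilon> :: real assume \<epsilon>: "\<epsilon> > 0"
  let ?\<psi> = "abs_L2 \<psi>"
  have si: "square_integrable \<psi>"
    by (rule square_integrable_test[OF \<psi>])
  obtain R0 where R0: "\<And>x. \<psi> x \<noteq> 0 \<Longrightarrow> norm x \<le> R0" "R0 > 0"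
    using test_functionD(3)[OF \<psi>] unfolding bounded_pos by auto
  \<comment> \<open>A strict bound, so that translates by multiples of \<open>2 R\<close> have disjoint supports.\<close>
  define R where "R = R0 + 1"
  have R: "R > 0" "\<And>x. \<psi> x \<noteq> 0 \<Longrightarrow> norm x < R"
    using R0 by (force simp: R_def)+
  have M: "M \<ge> 0"
    using bound[of 0] norm_ge_zero order_trans by blast
  define t where "t k = translate_L2 ((2 * R * real k) *\<^sub>R axis i 1) ?\<psi>" for k
  have avg: "real N * \<bar>inner (u n) ?\<psi>\<bar> \<le> M * (sqrt (real N) * norm ?\<psi>) + real N * (2 * R * real N * norm (w n) * norm ?\<psi>)"
    for N n
  proof -
    have "(norm (\<Sum>k<N. t k))\<^sup>2 = real N * (norm ?\<psi>)\<^sup>2"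
      unfolding t_def by (rule norm_sum_disjoint_translates[OF si R(2)])
    also have "\<dots> = (sqrt (real N) * norm ?\<psi>)\<^sup>2"
      by (simp add: power_mult_distrib)
    finally have "norm (\<Sum>k<N. t k) = sqrt (real N) * norm ?\<psi>"
      by (rule power2_eq_imp_eq) simp_all
    moreover have "\<bar>inner (u n) (\<Sum>k<N. t k)\<bar> \<le> M * norm (\<Sum>k<N. t k)"
      by (rule order_trans[OF Cauchy_Schwarz_ineq2]) (intro mult_right_mono bound norm_ge_zero)
    ultimately have 1: "\<bar>inner (u n) (\<Sum>k<N. t k)\<bar> \<le> M * (sqrt (real N) * norm ?\<psi>)"
      by simp
    have "\<bar>\<Sum>k<N. inner (u n) (t k) - inner (u n) ?\<psi>\<bar> \<le> (\<Sum>k<N. \<bar>inner (u n) (t k) - inner (u n) ?\<psi>\<bar>)"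
      by (rule sum_abs)
    also have "\<dots> \<le> (\<Sum>k<N. 2 * R * real N * norm (w n) * norm ?\<psi>)"
    proof (rule sum_mono)
      fix k assume "k \<in> {..<N}"
      have "\<bar>inner (u n) (t k) - inner (u n) ?\<psi>\<bar> \<le> \<bar>2 * R * real k\<bar> * norm (w n) * norm ?\<psi>"
        unfolding t_def by (rule translation_difference_bound[OF wp])
      also have "\<dots> \<le> 2 * R * real N * norm (w n) * norm ?\<psi>"
        using R \<open>k \<in> {..<N}\<close> by (intro mult_right_mono) auto
      finally show "\<bar>inner (u n) (t k) - inner (u n) ?\<psi>\<bar> \<le> 2 * R * real N * norm (w n) * norm ?\<psi>" .
    qed
    finally have 2: "\<bar>\<Sum>k<N. inner (u n) (t k) - inner (u n) ?\<psi>\<bar> \<le> real N * (2 * R * real N * norm (w n) * norm ?\<psi>)"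
      by simp
    have "real N * inner (u n) ?\<psi> = inner (u n) (\<Sum>k<N. t k) - (\<Sum>k<N. inner (u n) (t k) - inner (u n) ?\<psi>)"
      by (simp add: inner_sum_right sum_subtractf)
    then have "\<bar>real N * inner (u n) ?\<psi>\<bar> \<le> M * (sqrt (real N) * norm ?\<psi>) + real N * (2 * R * real N * norm (w n) * norm ?\<psi>)"
      using 1 2 by linarith
    then show ?thesis by (simp add: abs_mult)
  qed
  have "(\<lambda>N. M * norm ?\<psi> / sqrt (real N)) \<longlonglongrightarrow> 0"
    by (rule real_tendsto_divide_at_top[OF tendsto_const
          filterlim_compose[OF sqrt_at_top filterlim_real_sequentially]])
  then have "eventually (\<lambda>N. M * norm ?\<psi> / sqrt (real N) < \<epsilon> / 2) sequentially"
    using \<epsilon> by (intro order_tendstoD) auto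
  then have "eventually (\<lambda>N. M * norm ?\<psi> / sqrt (real N) < \<epsilon> / 2 \<and> N \<ge> 1) sequentially"
    using eventually_ge_at_top by (rule eventually_conj)
  then obtain N where N: "M * norm ?\<psi> / sqrt (real N) < \<epsilon> / 2" "N \<ge> 1"
    by (auto simp: eventually_sequentially)
  have "(\<lambda>n. 2 * R * real N * norm (w n) * norm ?\<psi>) \<longlonglongrightarrow> 2 * R * real N * 0 * norm ?\<psi>"
    by (intro tendsto_intros w)
  then have "eventually (\<lambda>n. 2 * R * real N * norm (w n) * norm ?\<psi> < \<epsilon> / 2) sequentially"
    using \<epsilon> by (intro order_tendstoD) auto
  then obtain n0 where n0: "\<And>n. n \<ge> n0 \<Longrightarrow> 2 * R * real N * norm (w n) * norm ?\<psi> < \<epsilon> / 2"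
    by (auto simp: eventually_sequentially)
  show "\<exists>n0. \<forall>n\<ge>n0. norm (inner (u n) ?\<psi> - 0) < \<epsilon>"
  proof (intro exI allI impI)
    fix n assume n: "n \<ge> n0"
    have "M * (sqrt (real N) * norm ?\<psi>) = real N * (M * norm ?\<psi> / sqrt (real N))"
      using N(2) by (simp add: field_simps)
    then have "real N * \<bar>inner (u n) ?\<psi>\<bar> \<le> real N * (M * norm ?\<psi> / sqrt (real N) + 2 * R * real N * norm (w n) * norm ?\<psi>)"
      using avg[of N n] by (simp add: distrib_left)
    then have "\<bar>inner (u n) ?\<psi>\<bar> \<le> M * norm ?\<psi> / sqrt (real N) + 2 * R * real N * norm (w n) * norm ?\<psi>"
      using N(2) by (subst (asm) mult_le_cancel_left_pos) auto
    then show "norm (inner (u n) ?\<psi> - 0) < \<epsilon>"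
      using N(1) n0[OF n] unfolding real_norm_def diff_0_right by linarith
  qed
qed

theorem weakly_null:
  fixes u w :: "nat \<Rightarrow> (real^'n::finite) L2"
  assumes wp: "\<And>n. has_weak_partial (u n) i (w n)"
    and bound: "\<And>n. norm (u n) \<le> M"
    and w: "(\<lambda>n. norm (w n)) \<longlonglongrightarrow> 0"
  shows "(\<lambda>n. inner (u n) f) \<longlonglongrightarrow> 0"
proof (rule LIMSEQ_I)
  fix \<epsilon> :: real assume \<epsilon>: "\<epsilon> > 0"
  have M: "M \<ge> 0"
    using bound[of 0] norm_ge_zero order_trans by blast
  obtain \<psi> where \<psi>: "test_function \<psi>" "norm (f - abs_L2 \<psi>) < \<epsilon> / (2 * (M + 1))"
    using test_approximation[of "\<epsilon> / (2 * (M + 1))" f] \<epsilon> M by auto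
  have "eventually (\<lambda>n. dist (inner (u n) (abs_L2 \<psi>)) 0 < \<epsilon> / 2) sequentially"
    using weakly_null_test[OF wp bound w \<psi>(1)] \<epsilon> by (intro tendstoD) auto
  then obtain n0 where n0: "\<And>n. n \<ge> n0 \<Longrightarrow> \<bar>inner (u n) (abs_L2 \<psi>)\<bar> < \<epsilon> / 2"
    by (auto simp: eventually_sequentially dist_real_def)
  show "\<exists>n0. \<forall>n\<ge>n0. norm (inner (u n) f - 0) < \<epsilon>"
  proof (intro exI allI impI)
    fix n assume n: "n \<ge> n0"
    have "\<bar>inner (u n) (f - abs_L2 \<psi>)\<bar> \<le> (M + 1) * norm (f - abs_L2 \<psi>)"
      using Cauchy_Schwarz_ineq2[of "u n" "f - abs_L2 \<psi>"] bound[of n]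
        mult_right_mono[of "norm (u n)" "M + 1" "norm (f - abs_L2 \<psi>)"] by simp
    also have "\<dots> < \<epsilon> / 2"
      using \<psi>(2) M by (simp add: field_simps)
    finally show "norm (inner (u n) f - 0) < \<epsilon>"
      using n0[OF n] abs_triangle_ineq[of "inner (u n) (f - abs_L2 \<psi>)" "inner (u n) (abs_L2 \<psi>)"]
      by (simp add: inner_diff_right)
  qed
qed

section \<open>The metric coefficients\<close>

lemma BC_class_1_iff:
  "BC_class 1 f \<longleftrightarrow> f differentiable_on UNIV \<and> bounded (range f) \<and>
     (\<forall>i. continuous_on UNIV (partial i f) \<and> bounded (range (partial i f)))"
  by simp

lemma bounded_range_iff:
  fixes f :: "'a \<Rightarrow> real"
  shows "bounded (range f) \<longleftrightarrow> (\<exists>B\<ge>0. \<forall>x. \<bar>f x\<bar> \<le> B)"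
  by (auto simp: bounded_iff intro: order_trans[OF abs_ge_zero])

lemma bounded_range_add:
  fixes f g :: "'a \<Rightarrow> real"
  assumes "bounded (range f)" "bounded (range g)"
  shows "bounded (range (\<lambda>x. f x + g x))"
proof -
  obtain A B where "\<And>x. \<bar>f x\<bar> \<le> A" "\<And>x. \<bar>g x\<bar> \<le> B"
    using assms by (auto simp: bounded_range_iff)
  then have "\<bar>f x + g x\<bar> \<le> A + B" for x
    by (meson abs_triangle_ineq add_mono order_trans)
  then show ?thesis by (auto simp: bounded_iff)
qed

lemma bounded_range_mult:
  fixes f g :: "'a \<Rightarrow> real"
  assumes "bounded (range f)" "bounded (range g)"
  shows "bounded (range (\<lambda>x. f x * g x))"
proof -
  obtain A B where "A \<ge> 0" "\<And>x. \<bar>f x\<bar> \<le> A" "\<And>x. \<bar>g x\<bar> \<le> B"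
    using assms by (auto simp: bounded_range_iff)
  then have "\<bar>f x * g x\<bar> \<le> A * B" for x
    unfolding abs_mult by (intro mult_mono) auto
  then show ?thesis by (auto simp: bounded_iff)
qed

lemma BC_class_1_const: "BC_class 1 (\<lambda>_. c)"
  unfolding BC_class_1_iff by (auto simp: partial_const)

lemma BC_class_1_add: "BC_class 1 f \<Longrightarrow> BC_class 1 g \<Longrightarrow> BC_class 1 (\<lambda>x. f x + g x)"
  unfolding BC_class_1_iff
  by (auto simp: partial_add bounded_range_add intro!: continuous_intros derivative_intros)

lemma BC_class_1_mult: "BC_class 1 f \<Longrightarrow> BC_class 1 g \<Longrightarrow> BC_class 1 (\<lambda>x. f x * g x)"
  unfolding BC_class_1_iff
  by (auto simp: partial_mult bounded_range_add bounded_range_mult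
      intro!: continuous_intros derivative_intros intro: differentiable_imp_continuous_on)

lemma BC_class_1_powr:
  assumes f: "BC_class 1 f" and ge1: "\<And>x. f x \<ge> 1"
  shows "BC_class 1 (\<lambda>x. f x powr a)"
proof -
  have diff: "f differentiable_on UNIV" and bf: "bounded (range f)"
    and bp: "bounded (range (partial i f))" and cp: "continuous_on UNIV (partial i f)" for i
    using f by auto
  have cf: "continuous_on UNIV f"
    by (rule differentiable_imp_continuous_on[OF diff])
  have bpow: "bounded (range (\<lambda>x. f x powr b))" for b
  proof -
    obtain M where "\<And>x. \<bar>f x\<bar> \<le> M"
      using bf by (auto simp: bounded_range_iff)
    then have M: "f x \<le> M" for x
      using abs_le_D1 by blast
    have "\<bar>f x powr b\<bar> \<le> M powr \<bar>b\<bar>" for x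
    proof -
      have "f x powr b \<le> f x powr \<bar>b\<bar>"
        using ge1[of x] by (intro powr_mono) auto
      also have "\<dots> \<le> M powr \<bar>b\<bar>"
        using ge1[of x] M[of x] by (intro powr_mono2) auto
      finally show ?thesis by simp
    qed
    then show ?thesis by (auto simp: bounded_iff)
  qed
  have "((\<lambda>y. y powr a) has_real_derivative a * f x powr (a - 1)) (at (f x))" for x
    using ge1[of x] by (intro has_real_derivative_powr) auto
  note c = partial_compose[of "\<lambda>y. y powr a" "\<lambda>y. a * y powr (a - 1)" f, OF this diff]
  have cont: "continuous_on UNIV (\<lambda>x. a * f x powr (a - 1) * partial i f x)" for i
    using ge1 by (intro continuous_intros cf cp) (metis not_one_le_zero)
  have "bounded (range (\<lambda>x. a * f x powr (a - 1) * partial i f x))" for i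
    by (intro bounded_range_mult bpow bp) auto
  then show ?thesis
    unfolding BC_class_1_iff c(2) using c(1) bpow cont by simp
qed

lemma matrix_inv_eqI:
  fixes A B :: "real^'n^'n"
  assumes "A ** B = mat 1" "B ** A = mat 1"
  shows "matrix_inv A = B"
proof -
  let ?C = "matrix_inv A"
  have "A ** ?C = mat 1 \<and> ?C ** A = mat 1"
    unfolding matrix_inv_def by (rule someI[of _ B]) (use assms in auto)
  then have "?C = ?C ** (A ** B)" "?C ** A = mat 1"
    using assms by auto
  then show ?thesis
    by (metis matrix_mul_assoc matrix_mul_lid)
qed

text \<open>The metric induced by the graph of a function \<open>\<phi>\<close> of class \<open>BC\<^sup>2\<close>.\<close>

locale graph_metric =
  fixes \<phi> :: "real^2 \<Rightarrow> real"
  assumes BC2: "BC_class 2 \<phi>"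
begin

text \<open>The closed form of the metric determinant.\<close>

definition G :: "real^2 \<Rightarrow> real" where
  "G x = 1 + (partial 1 \<phi> x)\<^sup>2 + (partial 2 \<phi> x)\<^sup>2"

lemma metric_eq:
  "metric \<phi> x $ 1 $ 1 = 1 + (partial 1 \<phi> x)\<^sup>2"
  "metric \<phi> x $ 1 $ 2 = partial 1 \<phi> x * partial 2 \<phi> x"
  "metric \<phi> x $ 2 $ 1 = partial 1 \<phi> x * partial 2 \<phi> x"
  "metric \<phi> x $ 2 $ 2 = 1 + (partial 2 \<phi> x)\<^sup>2"
  by (simp_all add: metric_def tangent_def inner_vec_def sum_3 power2_eq_square)

lemma metric_det_eq: "metric_det \<phi> x = G x"
  by (simp add: metric_det_def det_2 metric_eq G_def power2_eq_square algebra_simps)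

lemma G_ge_1: "G x \<ge> 1"
  by (simp add: G_def)

text \<open>The closed form of the inverse metric, by Cramer's rule.\<close>

definition inv_metric :: "real^2 \<Rightarrow> real^2^2" where
  "inv_metric x = (\<chi> \<alpha> \<beta>. (if \<alpha> = 1 \<and> \<beta> = 1 then 1 + (partial 2 \<phi> x)\<^sup>2
      else if \<alpha> = 2 \<and> \<beta> = 2 then 1 + (partial 1 \<phi> x)\<^sup>2
      else - (partial 1 \<phi> x * partial 2 \<phi> x)) / G x)"

lemma matrix_inv_metric: "matrix_inv (metric \<phi> x) = inv_metric x"
proof (rule matrix_inv_eqI)
  have "G x \<noteq> 0" using G_ge_1[of x] by linarith
  then show "metric \<phi> x ** inv_metric x = mat 1" "inv_metric x ** metric \<phi> x = mat 1"
    by (simp_all add: vec_eq_iff forall_2 matrix_matrix_mult_def sum_2 metric_eq inv_metric_def mat_def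
        divide_simps G_def) (simp_all add: power2_eq_square algebra_simps)
qed

text \<open>The coefficients \<open>sqrt G g\<^sup>\<alpha>\<^sup>\<beta>\<close>.\<close>

definition coef :: "2 \<Rightarrow> 2 \<Rightarrow> real^2 \<Rightarrow> real" where
  "coef \<alpha> \<beta> x = sqrt (metric_det \<phi> x) * matrix_inv (metric \<phi> x) $ \<alpha> $ \<beta>"

lemma coef_eq:
  "coef \<alpha> \<beta> x = (if \<alpha> = 1 \<and> \<beta> = 1 then 1 + partial 2 \<phi> x * partial 2 \<phi> x
      else if \<alpha> = 2 \<and> \<beta> = 2 then 1 + partial 1 \<phi> x * partial 1 \<phi> x
      else (- 1) * (partial 1 \<phi> x * partial 2 \<phi> x)) * G x powr (- 1 / 2)"
proof -
  have "G x powr (- 1 / 2) = sqrt (G x) / G x"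
    using G_ge_1[of x] by (simp add: powr_minus powr_half_sqrt sqrt_divide_self_eq)
  then show ?thesis
    by (simp add: coef_def metric_det_eq matrix_inv_metric inv_metric_def power2_eq_square)
qed

lemma coef_commute: "coef \<alpha> \<beta> = coef \<beta> \<alpha>"
  by (rule ext) (auto simp: coef_eq)

lemma BC1_partial: "BC_class 1 (partial i \<phi>)"
  using BC2 by (simp add: numeral_2_eq_2)

lemma BC1_G: "BC_class 1 G"
  unfolding G_def power2_eq_square
  by (intro BC_class_1_add BC_class_1_mult BC_class_1_const BC1_partial)

lemma BC1_G_powr: "BC_class 1 (\<lambda>x. G x powr a)"
  by (rule BC_class_1_powr[OF BC1_G G_ge_1])

lemma BC1_coef: "BC_class 1 (coef \<alpha> \<beta>)"
proof -
  have *: "BC_class 1 (\<lambda>x. if P then f x else g x)" if "BC_class 1 f" "BC_class 1 g"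
    for P and f g :: "real^2 \<Rightarrow> real"
    using that by (cases P) (simp_all del: BC_class.simps)
  show ?thesis
    unfolding coef_eq
    by (intro BC_class_1_mult BC1_G_powr * BC_class_1_add BC_class_1_const BC1_partial)
qed

lemmas multiplier_coef = BC_class_1_multiplier(1)[OF BC1_coef]
lemmas multiplier_G = BC_class_1_multiplier(1)[OF BC1_G_powr]

text \<open>Ellipticity, from the identity
  \<open>sqrt G g\<^sup>\<alpha>\<^sup>\<beta> \<xi>\<^sub>\<alpha> \<xi>\<^sub>\<beta> = (\<bar>\<xi>\<bar>\<^sup>2 + (\<partial>\<^sub>2\<phi> \<xi>\<^sub>1 - \<partial>\<^sub>1\<phi> \<xi>\<^sub>2)\<^sup>2) / sqrt G\<close>.  Only the first component is
  retained, since one direction suffices for \<open>weakly_null\<close>.\<close>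

lemma coef_elliptic:
  "(\<Sum>\<alpha>\<in>UNIV. \<Sum>\<beta>\<in>UNIV. coef \<alpha> \<beta> x * (\<xi> \<beta> * \<xi> \<alpha>)) \<ge> G x powr (- 1 / 2) * (\<xi> 1)\<^sup>2"
proof -
  let ?p = "partial 1 \<phi> x" and ?q = "partial 2 \<phi> x"
  have "(\<Sum>\<alpha>\<in>UNIV. \<Sum>\<beta>\<in>UNIV. coef \<alpha> \<beta> x * (\<xi> \<beta> * \<xi> \<alpha>))
      = G x powr (- 1 / 2) * ((\<xi> 1)\<^sup>2 + ((\<xi> 2)\<^sup>2 + (?q * \<xi> 1 - ?p * \<xi> 2)\<^sup>2))"
    by (simp add: sum_2 coef_eq power2_eq_square algebra_simps)
  moreover have "(\<xi> 1)\<^sup>2 \<le> (\<xi> 1)\<^sup>2 + ((\<xi> 2)\<^sup>2 + (?q * \<xi> 1 - ?p * \<xi> 2)\<^sup>2)"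
    by simp
  ultimately show ?thesis
    by (simp add: mult_left_mono)
qed

section \<open>The energy form\<close>

text \<open>The form \<open>a(f, h) = \<integral> sqrt G g\<^sup>\<alpha>\<^sup>\<beta> \<partial>\<^sub>\<beta>f \<partial>\<^sub>\<alpha>h\<close>, without the factor \<open>\<kappa>\<close>.\<close>

definition dirichlet :: "(real^2) L2 \<Rightarrow> (real^2) L2 \<Rightarrow> real" where
  "dirichlet f h = (\<Sum>\<alpha>\<in>UNIV. \<Sum>\<beta>\<in>UNIV. inner (mult_L2 (coef \<alpha> \<beta>) (weak_partial \<beta> f)) (weak_partial \<alpha> h))"

text \<open>Multiplication by \<open>sqrt G\<close>; the weighted scalar product of \<open>u\<close> and \<open>w\<close> is
  \<open>inner (weighted u) w\<close>.\<close>

definition weighted :: "(real^2) L2 \<Rightarrow> (real^2) L2" where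
  "weighted = mult_L2 (\<lambda>x. G x powr (1 / 2))"

lemma bounded_linear_weighted: "bounded_linear weighted"
  unfolding weighted_def by (rule bounded_linear_mult_L2[OF multiplier_G])

lemma inner_weighted_commute: "inner (weighted u) w = inner (weighted w) u"
  unfolding weighted_def by (rule inner_mult_L2_swap[OF multiplier_G])

lemma dirichlet_commute: "dirichlet f h = dirichlet h f"
proof -
  have "dirichlet h f = (\<Sum>\<alpha>\<in>UNIV. \<Sum>\<beta>\<in>UNIV. inner (mult_L2 (coef \<beta> \<alpha>) (weak_partial \<beta> h)) (weak_partial \<alpha> f))"
    by (simp add: dirichlet_def coef_commute)
  also have "\<dots> = (\<Sum>\<alpha>\<in>UNIV. \<Sum>\<beta>\<in>UNIV. inner (mult_L2 (coef \<beta> \<alpha>) (weak_partial \<alpha> f)) (weak_partial \<beta> h))"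
    by (intro sum.cong refl inner_mult_L2_swap[OF multiplier_coef])
  also have "\<dots> = dirichlet f h"
    unfolding dirichlet_def by (rule sum.swap)
  finally show ?thesis ..
qed

lemma dirichlet_coercive:
  obtains c where "c > 0" "\<And>f. dirichlet f f \<ge> c * (norm (weak_partial 1 f))\<^sup>2"
proof -
  obtain M where "M \<ge> 0" "\<And>x. \<bar>G x\<bar> \<le> M"
    using BC1_G by (auto simp: bounded_range_iff)
  then have M: "G x \<le> M" for x
    using abs_le_D1 by blast
  have M1: "M \<ge> 1" using M[of 0] G_ge_1[of 0] by linarith
  define c where "c = M powr (- 1 / 2)"
  have cG: "c \<le> G x powr (- 1 / 2)" for x
    unfolding c_def using M[of x] G_ge_1[of x] by (intro powr_mono2') auto
  have "dirichlet f f \<ge> c * (norm (weak_partial 1 f))\<^sup>2" for f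
  proof -
    define \<xi> where "\<xi> \<alpha> = rep_L2 (weak_partial \<alpha> f)" for \<alpha>
    have int: "integrable lborel (\<lambda>x. coef \<alpha> \<beta> x * (\<xi> \<beta> x * \<xi> \<alpha> x))" for \<alpha> \<beta>
      unfolding \<xi>_def by (rule integrable_multiplier[OF multiplier_coef])
    have "c * (norm (weak_partial 1 f))\<^sup>2 = (\<integral>x. c * (\<xi> 1 x)\<^sup>2 \<partial>lborel)"
      unfolding power2_norm_eq_inner inner_L2_rep \<xi>_def by (simp add: power2_eq_square)
    also have "\<dots> \<le> (\<integral>x. (\<Sum>\<alpha>\<in>UNIV. \<Sum>\<beta>\<in>UNIV. coef \<alpha> \<beta> x * (\<xi> \<beta> x * \<xi> \<alpha> x)) \<partial>lborel)"
    proof (rule integral_mono)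
      show "integrable lborel (\<lambda>x. c * (\<xi> 1 x)\<^sup>2)"
        using square_integrable_rep[of "weak_partial 1 f"] by (simp add: \<xi>_def square_integrable_def)
      show "integrable lborel (\<lambda>x. \<Sum>\<alpha>\<in>UNIV. \<Sum>\<beta>\<in>UNIV. coef \<alpha> \<beta> x * (\<xi> \<beta> x * \<xi> \<alpha> x))"
        by (intro Bochner_Integration.integrable_sum int)
      show "c * (\<xi> 1 x)\<^sup>2 \<le> (\<Sum>\<alpha>\<in>UNIV. \<Sum>\<beta>\<in>UNIV. coef \<alpha> \<beta> x * (\<xi> \<beta> x * \<xi> \<alpha> x))" for x
        using mult_right_mono[OF cG[of x], of "(\<xi> 1 x)\<^sup>2"] coef_elliptic[of x "\<lambda>\<alpha>. \<xi> \<alpha> x"] by simp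
    qed
    also have "\<dots> = dirichlet f f"
      unfolding dirichlet_def inner_mult_L2_left[OF multiplier_coef] \<xi>_def[symmetric]
      by (simp add: Bochner_Integration.integral_sum Bochner_Integration.integrable_sum int)
    finally show ?thesis .
  qed
  then show ?thesis
    using that[of c] M1 by (simp add: c_def)
qed

lemma norm_le_weighted: "(norm u)\<^sup>2 \<le> inner (weighted u) u"
proof -
  have "(norm u)\<^sup>2 = (\<integral>x. rep_L2 u x * rep_L2 u x \<partial>lborel)"
    by (simp add: power2_norm_eq_inner inner_L2_rep)
  also have "\<dots> \<le> (\<integral>x. G x powr (1 / 2) * (rep_L2 u x * rep_L2 u x) \<partial>lborel)"
  proof (rule integral_mono[OF integrable_rep_mult integrable_multiplier[OF multiplier_G]])
    fix x
    have "1 \<le> G x powr (1 / 2)"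
      using G_ge_1[of x] by (simp add: ge_one_powr_ge_zero)
    then show "rep_L2 u x * rep_L2 u x \<le> G x powr (1 / 2) * (rep_L2 u x * rep_L2 u x)"
      using mult_right_mono[of 1 "G x powr (1 / 2)" "rep_L2 u x * rep_L2 u x"] by simp
  qed
  also have "\<dots> = inner (weighted u) u"
    by (simp add: weighted_def inner_mult_L2_left[OF multiplier_G])
  finally show ?thesis .
qed

lemma norm_quarter: "(norm (mult_L2 (\<lambda>x. metric_det \<phi> x powr (1 / 4)) u))\<^sup>2 = inner (weighted u) u"
proof -
  have "(norm (mult_L2 (\<lambda>x. G x powr (1 / 4)) u))\<^sup>2
      = inner (mult_L2 (\<lambda>x. G x powr (1 / 4)) (mult_L2 (\<lambda>x. G x powr (1 / 4)) u)) u"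
    by (simp add: power2_norm_eq_inner inner_mult_L2_commute[OF multiplier_G])
  also have "\<dots> = inner (weighted u) u"
    by (simp add: mult_L2_mult[OF multiplier_G multiplier_G] weighted_def powr_add[symmetric])
  finally show ?thesis
    by (simp add: metric_det_eq)
qed

lemma has_weak_partial_weak_partial:
  "sobolev (Suc k) u \<Longrightarrow> has_weak_partial u i (weak_partial i u)"
  unfolding weak_partial_def by (auto intro: someI_ex)

text \<open>The weak formulation \<open>\<langle>L f, h\<rangle> = \<kappa> a(f, h)\<close> in the weighted scalar product.  The weight cancels
  the factor \<open>1 / sqrt G\<close> of \<open>L\<close>, and the divergence is then integrated by parts.\<close>

lemma inner_surface_op:
  assumes f: "sobolev 2 f" and h: "sobolev 2 h"
  shows "inner (weighted (surface_op \<kappa> \<phi> f)) h = \<kappa> * dirichlet f h"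
proof -
  define W where "W \<alpha> = (\<Sum>\<beta>\<in>UNIV. mult_L2 (coef \<alpha> \<beta>) (weak_partial \<beta> f))" for \<alpha>
  have "has_weak_partial (weak_partial \<beta> f) \<alpha> (weak_partial \<alpha> (weak_partial \<beta> f))" for \<alpha> \<beta>
    using f[unfolded numeral_2_eq_2 sobolev.simps(2)[of "Suc 0"]] has_weak_partial_weak_partial[of 0] by blast
  note prod = has_weak_partial_mult[OF BC1_coef this]
  have "\<exists>w. has_weak_partial (W \<alpha>) \<alpha> w" for \<alpha>
    unfolding W_def by (rule exI, rule has_weak_partial_sum, rule prod)
  then have W: "has_weak_partial (W \<alpha>) \<alpha> (weak_partial \<alpha> (W \<alpha>))" for \<alpha>
    unfolding weak_partial_def[of \<alpha> "W \<alpha>"] by (rule someI_ex)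
  have H: "has_weak_partial h \<alpha> (weak_partial \<alpha> h)" for \<alpha>
    using h has_weak_partial_weak_partial[of 1] by (simp only: numeral_2_eq_2 One_nat_def)
  have surf: "surface_op \<kappa> \<phi> f = mult_L2 (\<lambda>x. - \<kappa> * G x powr (- 1 / 2)) (\<Sum>\<alpha>\<in>UNIV. weak_partial \<alpha> (W \<alpha>))"
  proof -
    have "- \<kappa> / sqrt (G x) = - \<kappa> * G x powr (- 1 / 2)" for x
      using G_ge_1[of x] by (simp add: powr_minus powr_half_sqrt inverse_eq_divide)
    then show ?thesis
      by (simp add: surface_op_def W_def coef_def[abs_def] metric_det_eq)
  qed
  have mul: "L2_multiplier (\<lambda>x. - \<kappa> * G x powr (- 1 / 2))"
    by (intro BC_class_1_multiplier(1) BC_class_1_mult BC_class_1_const BC1_G_powr)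
  have "weighted (surface_op \<kappa> \<phi> f) = mult_L2 (\<lambda>x. - \<kappa>) (\<Sum>\<alpha>\<in>UNIV. weak_partial \<alpha> (W \<alpha>))"
  proof -
    have "G x powr (1 / 2) * (- \<kappa> * G x powr (- 1 / 2)) = - \<kappa>" for x
      using G_ge_1[of x] by (simp add: powr_minus)
    then show ?thesis
      unfolding surf weighted_def mult_L2_mult[OF multiplier_G mul] by presburger
  qed
  also have "\<dots> = (- \<kappa>) *\<^sub>R (\<Sum>\<alpha>\<in>UNIV. weak_partial \<alpha> (W \<alpha>))"
    by (rule mult_L2_const)
  finally have "inner (weighted (surface_op \<kappa> \<phi> f)) h = - \<kappa> * (\<Sum>\<alpha>\<in>UNIV. inner (weak_partial \<alpha> (W \<alpha>)) h)"
    by (simp add: inner_sum_left)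
  also have "\<dots> = \<kappa> * (\<Sum>\<alpha>\<in>UNIV. inner (W \<alpha>) (weak_partial \<alpha> h))"
    by (simp add: weak_integration_by_parts[OF W H] sum_negf)
  also have "\<dots> = \<kappa> * dirichlet f h"
    by (simp add: W_def dirichlet_def inner_sum_left)
  finally show ?thesis .
qed

end

section \<open>Decay of strong solutions\<close>

text \<open>A strong solution \<open>v\<close> over the graph of \<open>\<phi>\<close>.\<close>

locale strong_flow = graph_metric +
  fixes \<kappa> :: real and v\<^sub>0 :: "(real^2) L2" and v :: "real \<Rightarrow> (real^2) L2"
  assumes \<kappa>: "\<kappa> > 0" and sol: "strong_solution \<kappa> \<phi> v\<^sub>0 v"
begin

lemma sobolev_v: "t > 0 \<Longrightarrow> sobolev 2 (v t)"
  using sol by (simp add: strong_solution_def)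

lemma has_vector_derivative_v:
  assumes "t > 0"
  shows "(v has_vector_derivative - surface_op \<kappa> \<phi> (v t)) (at t)"
proof -
  have "v differentiable at t"
    using sol assms by (auto simp: strong_solution_def C1_differentiable_on_eq)
  then have "(v has_vector_derivative vector_derivative v (at t)) (at t)"
    by (simp add: vector_derivative_works)
  moreover have "vector_derivative v (at t) = - surface_op \<kappa> \<phi> (v t)"
    using sol assms by (simp add: strong_solution_def eq_neg_iff_add_eq_0)
  ultimately show ?thesis by simp
qed

lemma has_vector_derivative_weighted_v:
  "t > 0 \<Longrightarrow> ((\<lambda>t. weighted (v t)) has_vector_derivative - weighted (surface_op \<kappa> \<phi> (v t))) (at t)"
  using bounded_linear.has_vector_derivative[OF bounded_linear_weighted has_vector_derivative_v]
  by (simp add: linear_neg[OF bounded_linear.linear[OF bounded_linear_weighted]])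

text \<open>The squared norm of \<open>G\<^sup>1\<^sup>/\<^sup>4 v(t)\<close>.\<close>

definition energy :: "real \<Rightarrow> real" where
  "energy t = inner (weighted (v t)) (v t)"

lemma energy_nonneg: "energy t \<ge> 0"
  using norm_le_weighted[of "v t"] zero_le_power2[of "norm (v t)"] unfolding energy_def by linarith

lemma energy_has_derivative:
  assumes "t > 0"
  shows "(energy has_real_derivative - (2 * \<kappa> * dirichlet (v t) (v t))) (at t)"
proof -
  have "((\<lambda>t. inner (weighted (v t)) (v t)) has_vector_derivative
      inner (weighted (v t)) (- surface_op \<kappa> \<phi> (v t)) + inner (- weighted (surface_op \<kappa> \<phi> (v t))) (v t)) (at t)"
    by (rule bounded_bilinear.has_vector_derivative[OF bounded_bilinear_inner
          has_vector_derivative_weighted_v[OF assms] has_vector_derivative_v[OF assms]])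
  moreover have "inner (weighted (v t)) (surface_op \<kappa> \<phi> (v t)) = \<kappa> * dirichlet (v t) (v t)"
    by (subst inner_weighted_commute) (rule inner_surface_op[OF sobolev_v sobolev_v, OF assms assms])
  moreover have "inner (weighted (surface_op \<kappa> \<phi> (v t))) (v t) = \<kappa> * dirichlet (v t) (v t)"
    by (rule inner_surface_op[OF sobolev_v sobolev_v, OF assms assms])
  ultimately show ?thesis
    unfolding energy_def[abs_def] has_real_derivative_iff_has_vector_derivative by (simp add: mult.assoc)
qed

lemma dirichlet_nonneg: "dirichlet f f \<ge> 0"
proof -
  obtain c where "c > 0" "dirichlet f f \<ge> c * (norm (weak_partial 1 f))\<^sup>2"
    using dirichlet_coercive by metis
  then show ?thesis
    by (intro order_trans[OF _ \<open>c * _ \<le> _\<close>]) simp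
qed

lemma energy_antimono:
  assumes "0 < s" "s \<le> t"
  shows "energy t \<le> energy s"
proof (rule DERIV_nonpos_imp_nonincreasing[OF assms(2)])
  fix x assume "s \<le> x" "x \<le> t"
  then show "\<exists>y. (energy has_real_derivative y) (at x) \<and> y \<le> 0"
    using energy_has_derivative[of x] assms(1) \<kappa> dirichlet_nonneg[of "v x"] by force
qed

text \<open>By symmetry of the operator, the weighted scalar product of \<open>v s\<close> and \<open>v r\<close> depends only
  on \<open>s + r\<close>.\<close>

lemma inner_weighted_flow:
  assumes "s > 0" "r > 0"
  shows "inner (weighted (v s)) (v r) = energy ((s + r) / 2)"
proof -
  define c where "c = s + r"
  define F where "F t = inner (weighted (v t)) (v (c - t))" for t
  have "(F has_real_derivative 0) (at t)" if "0 < t" "t < c" for t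
  proof -
    have t: "c - t > 0" using that by simp
    have "((\<lambda>t. c - t) has_vector_derivative -1) (at t)"
      by (auto intro!: derivative_eq_intros)
    from vector_diff_chain_at[OF this has_vector_derivative_v[OF t]]
    have "((\<lambda>t. v (c - t)) has_vector_derivative surface_op \<kappa> \<phi> (v (c - t))) (at t)"
      by (simp add: o_def)
    then have "(F has_vector_derivative inner (weighted (v t)) (surface_op \<kappa> \<phi> (v (c - t)))
        + inner (- weighted (surface_op \<kappa> \<phi> (v t))) (v (c - t))) (at t)"
      unfolding F_def
      by (rule bounded_bilinear.has_vector_derivative[OF bounded_bilinear_inner
            has_vector_derivative_weighted_v[OF that(1)]])
    moreover have "inner (weighted (v t)) (surface_op \<kappa> \<phi> (v (c - t))) = \<kappa> * dirichlet (v (c - t)) (v t)"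
      by (subst inner_weighted_commute) (rule inner_surface_op[OF sobolev_v sobolev_v, OF t that(1)])
    moreover have "inner (weighted (surface_op \<kappa> \<phi> (v t))) (v (c - t)) = \<kappa> * dirichlet (v t) (v (c - t))"
      by (rule inner_surface_op[OF sobolev_v sobolev_v, OF that(1) t])
    ultimately show ?thesis
      by (simp add: has_real_derivative_iff_has_vector_derivative dirichlet_commute[of "v t"])
  qed
  then have "F s = F (c / 2)"
    using assms by (intro DERIV_isconst3[of 0 c]) (auto simp: c_def)
  then show ?thesis
    by (simp add: F_def c_def energy_def field_simps)
qed

text \<open>The energy is nonincreasing and nonnegative, so its decrements over unit intervals tend to zero;
  the mean value theorem turns each decrement into a value of the dissipation.\<close>

lemma dirichlet_null_sequence:
  obtains \<xi> :: "nat \<Rightarrow> real" where "\<And>n. \<xi> n > 1" "(\<lambda>n. dirichlet (v (\<xi> n)) (v (\<xi> n))) \<longlonglongrightarrow> 0"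
proof -
  have "\<forall>n. \<exists>z. real n + 1 < z \<and> z < real n + 2 \<and>
      energy (real n + 2) - energy (real n + 1) = (real n + 2 - (real n + 1)) * - (2 * \<kappa> * dirichlet (v z) (v z))"
  proof
    fix n :: nat
    show "\<exists>z. real n + 1 < z \<and> z < real n + 2 \<and>
      energy (real n + 2) - energy (real n + 1) = (real n + 2 - (real n + 1)) * - (2 * \<kappa> * dirichlet (v z) (v z))"
    using MVT2[of "real n + 1" "real n + 2" energy "\<lambda>z. - (2 * \<kappa> * dirichlet (v z) (v z))"]
      energy_has_derivative by force
  qed
  from choice[OF this] obtain \<xi> where \<xi>: "\<And>n. real n + 1 < \<xi> n"
      and eq: "\<And>n. energy (real n + 2) - energy (real n + 1) = - (2 * \<kappa> * dirichlet (v (\<xi> n)) (v (\<xi> n)))"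
    by auto
  have "decseq (\<lambda>n. energy (real n + 1))"
    by (auto simp: decseq_def intro!: energy_antimono)
  then obtain L where L: "(\<lambda>n. energy (real n + 1)) \<longlonglongrightarrow> L"
    using decseq_convergent[of "\<lambda>n. energy (real n + 1)" 0] energy_nonneg by blast
  from LIMSEQ_Suc[OF L] have "(\<lambda>n. energy (real n + 2)) \<longlonglongrightarrow> L"
    by (simp add: add.commute add.left_commute)
  from tendsto_diff[OF L this]
  have "(\<lambda>n. (energy (real n + 1) - energy (real n + 2)) / (2 * \<kappa>)) \<longlonglongrightarrow> (L - L) / (2 * \<kappa>)"
    using \<kappa> by (intro tendsto_divide tendsto_const) auto
  moreover have "(energy (real n + 1) - energy (real n + 2)) / (2 * \<kappa>) = dirichlet (v (\<xi> n)) (v (\<xi> n))" for n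
    using eq[of n] \<kappa> by (simp add: field_simps)
  ultimately have "(\<lambda>n. dirichlet (v (\<xi> n)) (v (\<xi> n))) \<longlonglongrightarrow> 0" by simp
  moreover have "\<xi> n > 1" for n
    using \<xi>[of n] by linarith
  ultimately show ?thesis
    using that by blast
qed

text \<open>Along the times just found \<open>v\<close> tends weakly to zero, and its product with \<open>v 1\<close> is a value of
  the energy.\<close>

lemma energy_null_sequence:
  obtains \<tau> :: "nat \<Rightarrow> real" where "\<And>n. \<tau> n > 0" "(\<lambda>n. energy (\<tau> n)) \<longlonglongrightarrow> 0"
proof -
  obtain \<xi> :: "nat \<Rightarrow> real" where \<xi>: "\<And>n. \<xi> n > 1"
      and lim: "(\<lambda>n. dirichlet (v (\<xi> n)) (v (\<xi> n))) \<longlonglongrightarrow> 0"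
    using dirichlet_null_sequence by blast
  have pos: "\<xi> n > 0" for n using \<xi>[of n] by linarith
  obtain c where c: "c > 0" "\<And>f. dirichlet f f \<ge> c * (norm (weak_partial 1 f))\<^sup>2"
    using dirichlet_coercive by metis
  have "(\<lambda>n. norm (weak_partial 1 (v (\<xi> n)))) \<longlonglongrightarrow> 0"
  proof -
    have "(\<lambda>n. dirichlet (v (\<xi> n)) (v (\<xi> n)) / c) \<longlonglongrightarrow> 0"
      using tendsto_divide[OF lim tendsto_const[of c]] c(1) by simp
    then have "(\<lambda>n. (norm (weak_partial 1 (v (\<xi> n))))\<^sup>2) \<longlonglongrightarrow> 0"
      by (rule tendsto_sandwich[OF _ _ tendsto_const, rotated 2])
         (use c in \<open>auto simp: field_simps\<close>)
    then have "(\<lambda>n. sqrt ((norm (weak_partial 1 (v (\<xi> n))))\<^sup>2)) \<longlonglongrightarrow> sqrt 0"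
      by (rule tendsto_real_sqrt)
    then show ?thesis by simp
  qed
  moreover have "norm (v (\<xi> n)) \<le> sqrt (energy 1)" for n
  proof -
    have "(norm (v (\<xi> n)))\<^sup>2 \<le> energy 1"
      using norm_le_weighted[of "v (\<xi> n)"] energy_antimono[of 1 "\<xi> n"] \<xi>[of n]
      unfolding energy_def by linarith
    then show ?thesis by (rule real_le_rsqrt)
  qed
  moreover have "has_weak_partial (v (\<xi> n)) 1 (weak_partial 1 (v (\<xi> n)))" for n
    using has_weak_partial_weak_partial[of 1 "v (\<xi> n)" 1] sobolev_v[OF pos[of n]] by (simp only: numeral_2_eq_2 One_nat_def)
  ultimately have "(\<lambda>n. inner (v (\<xi> n)) (weighted (v 1))) \<longlonglongrightarrow> 0"
    by (intro weakly_null[where i = 1])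
  moreover have "inner (v (\<xi> n)) (weighted (v 1)) = energy ((1 + \<xi> n) / 2)" for n
    using inner_weighted_flow[OF zero_less_one pos[of n]] by (simp add: inner_commute)
  ultimately have "(\<lambda>n. energy ((1 + \<xi> n) / 2)) \<longlonglongrightarrow> 0" by simp
  moreover have "(1 + \<xi> n) / 2 > 0" for n using pos[of n] by simp
  ultimately show ?thesis
    using that[of "\<lambda>n. (1 + \<xi> n) / 2"] by blast
qed

lemma energy_tendsto_0: "(energy \<longlongrightarrow> 0) at_top"
proof (rule tendstoI)
  fix e :: real assume e: "e > 0"
  obtain \<tau> :: "nat \<Rightarrow> real" where \<tau>: "\<And>n. \<tau> n > 0" "(\<lambda>n. energy (\<tau> n)) \<longlonglongrightarrow> 0"
    using energy_null_sequence by blast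
  have "eventually (\<lambda>n. energy (\<tau> n) < e) sequentially"
    using \<tau>(2) e by (rule order_tendstoD)
  then obtain n where n: "energy (\<tau> n) < e"
    by (auto simp: eventually_sequentially)
  have "dist (energy t) 0 < e" if "t \<ge> \<tau> n" for t
    using energy_antimono[OF \<tau>(1)[of n] that] n energy_nonneg[of t] by simp
  then show "eventually (\<lambda>t. dist (energy t) 0 < e) at_top"
    by (auto simp: eventually_at_top_linorder)
qed

end

theorem theorem2p7:
  fixes \<kappa> C_star :: real and \<phi> :: "real^2 \<Rightarrow> real"
    and v\<^sub>0 :: "(real^2) L2" and v :: "real \<Rightarrow> (real^2) L2"
  assumes "\<kappa> > 0"
    and "BC_class 2 \<phi>"
    and "C_star > 0" and "maximal_regularity_constant \<kappa> C_star"
    and "(SUP x. norm (grad \<phi> x)) \<le> 1 / 4"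
    and "(SUP x. norm (grad \<phi> x)) \<le> 1 / (4 * sqrt C_star)"
    and "strong_solution \<kappa> \<phi> v\<^sub>0 v"
  shows "((\<lambda>t. norm (mult_L2 (\<lambda>x. metric_det \<phi> x powr (1 / 4)) (v t))) \<longlongrightarrow> 0) at_top"
proof -
  interpret strong_flow \<phi> \<kappa> v\<^sub>0 v
    using assms by unfold_locales
  have "norm (mult_L2 (\<lambda>x. metric_det \<phi> x powr (1 / 4)) (v t)) = sqrt (energy t)" for t
    by (simp add: energy_def norm_quarter[symmetric])
  then show ?thesis
    using tendsto_real_sqrt[OF energy_tendsto_0] by simp
qed

end
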